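(* Let $\mu_1,\dots,\mu_d$ be Borel probability measures on $\mathbb{R}^d$ and assume there exist $p_1,\dots,p_d\in(1,+\infty)$ with $\sum_{i=1}^d\frac1{p_i}=1$ and $\sum_{i=1}^d\int_{\mathbb{R}^d}\frac{|x|^{p_i}}{p_i}\,d\mu_i(x)<+\infty$. Consider $$(\mathcal{MK})\quad\sup_{\gamma\in\Pi(\mu_1,\dots,\mu_d)}\int_{(\mathbb{R}^d)^d}\det(x_1,\dots,x_d)\,d\gamma(x_1,\dots,x_d)$$ and $$(\mathcal{D})\quad\inf_{(\phi_1,\dots,\phi_d)\in\mathcal{E}}\sum_{i=1}^d\int_{\mathbb{R}^d}\phi_i\,d\mu_i,$$ where $\mathcal{E}$ is the set of $d$-tuples of lower semicontinuous functions $\phi_i:\mathbb{R}^d\to\mathbb{R}\cup\{+\infty\}$ such that $\sum_{i=1}^d\phi_i(x_i)\ge\det(x_1,\dots,x_d)$ for all $(x_1,\dots,x_d)\in(\mathbb{R}^d)^d$. Then both $(\mathcal{MK})$ and $(\mathcal{D})$ admit solutions and $\max(\mathcal{MK})=\min(\mathcal{D})$. Moreover $(\mathcal{D})$ admits a solution $(\phi_1,\dots,\phi_d)$ such that for all $i=1,\dots,d$ and all $x_i\in\mathbb{R}^d$, $$\phi_i(x_i)=\sup_{(x_j)_{j\ne i}\in(\mathbb{R}^d)^{d-1}}\Bigl\{\det(x_1,\dots,x_d)-\sum_{j\ne i}\phi_j(x_j)\Bigr\}.$$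
   Context: $\det(x_1,\dots,x_d)$ is the determinant of the $d\times d$ matrix with columns $x_1,\dots,x_d\in\mathbb{R}^d$. $\Pi(\mu_1,\dots,\mu_d)$ denotes the set of Borel probability measures $\gamma$ on $(\mathbb{R}^d)^d$ whose $i$-th marginal (push-forward under the $i$-th canonical projection) equals $\mu_i$ for each $i$. *)

theory Defs
  imports "HOL-Probability.Probability"
begin

definition lower_semicontinuous :: "('a::topological_space \<Rightarrow> ereal) \<Rightarrow> bool" where
  "lower_semicontinuous f \<longleftrightarrow> (\<forall>c. open {x. c < f x})"

text \<open>Integral of an extended-real valued function: integral of the positive part
minus integral of the negative part (each in [0,+oo]).  In the pathological case
oo - oo, Isabelle's ereal arithmetic gives +oo.\<close>
definition ereal_integral :: "'a measure \<Rightarrow> ('a \<Rightarrow> ereal) \<Rightarrow> ereal" where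
  "ereal_integral M f =
     enn2ereal (\<integral>\<^sup>+ x. e2ennreal (max 0 (f x)) \<partial>M)
     - enn2ereal (\<integral>\<^sup>+ x. e2ennreal (max 0 (- f x)) \<partial>M)"

definition det_cols :: "real ^ 'd ^ 'd \<Rightarrow> real" where
  "det_cols X = det (transpose X)"

definition couplings :: "('d::finite \<Rightarrow> (real ^ 'd) measure) \<Rightarrow> (real ^ 'd ^ 'd) measure set" where
  "couplings \<mu> = {\<gamma>. prob_space \<gamma> \<and> sets \<gamma> = sets borel \<and>
                     (\<forall>i. distr \<gamma> borel (\<lambda>X. X $ i) = \<mu> i)}"

definition dual_admissible :: "('d::finite \<Rightarrow> real ^ 'd \<Rightarrow> ereal) set" where
  "dual_admissible = {\<phi>. (\<forall>i. lower_semicontinuous (\<phi> i) \<and> (\<forall>x. \<phi> i x \<noteq> -\<infinity>)) \<and>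
                          (\<forall>X::real ^ 'd ^ 'd. (\<Sum>i\<in>UNIV. \<phi> i (X $ i)) \<ge> ereal (det_cols X))}"

definition dual_value :: "('d::finite \<Rightarrow> (real ^ 'd) measure) \<Rightarrow> ('d \<Rightarrow> real ^ 'd \<Rightarrow> ereal) \<Rightarrow> ereal" where
  "dual_value \<mu> \<phi> = (\<Sum>i\<in>UNIV. ereal_integral (\<mu> i) (\<phi> i))"

end

theory Submission
  imports Defs
begin

text \<open>
  A coupling \<open>\<gamma>\<close> and admissible potentials \<open>\<phi>\<close> with \<open>\<Sum>\<^sub>i \<phi>\<^sub>i(x\<^sub>i) = c(x)\<close> for \<open>\<gamma>\<close>-almost all \<open>x\<close> are both
  optimal, by weak duality. Such a pair exists for every continuous cost \<open>c\<close> on a Euclidean space: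

  For finitely supported marginals, maximising \<open>\<integral> c d\<gamma>\<close> plus a small logarithmic barrier over the
  polytope of couplings gives positive weights, whose first order condition says that \<open>c\<close> plus a
  small positive slack is a sum of potentials. In general the marginals are discretised along a
  countable basis of the topology. Recording all discretisations of all coordinates, the discrete
  couplings become laws of finitely valued processes, which have a limit by Kolmogorov's extension
  theorem; since the marginals are prescribed, this limit is almost surely the process of
  discretisations of a random point, whose law is the coupling \<open>\<gamma>\<close>. An epigraphical limit of the
  discrete potentials is admissible and has no slack on the support of \<open>\<gamma>\<close>.

  Conjugating the potentials one coordinate at a time lowers them, so the slack stays zero. The growth
  condition on \<open>c\<close>, which for the determinant comes from the inequality of arithmetic and geometric
  means, is only needed to integrate.
\<close>

section \<open>Lower semicontinuity and extended integrals\<close>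

lemma sum_ereal_neq_MInfty:
  fixes f :: "'i \<Rightarrow> ereal"
  assumes "\<And>i. i \<in> I \<Longrightarrow> f i \<noteq> -\<infinity>"
  shows "sum f I \<noteq> -\<infinity>"
  using assms by (induction I rule: infinite_finite_induct) auto

lemma
  fixes f :: "'i::finite \<Rightarrow> ereal"
  assumes sum: "(\<Sum>i\<in>UNIV. f i) = ereal r" and neq: "\<And>i. f i \<noteq> -\<infinity>"
  shows sum_eq_ereal_imp_real: "f i = ereal (real_of_ereal (f i))"
    and sum_real_of_ereal_eq: "(\<Sum>i\<in>UNIV. real_of_ereal (f i)) = r"
proof -
  have real: "f i = ereal (real_of_ereal (f i))" for i
    using sum neq[of i] sum_Pinfty[of f UNIV] by (cases "f i") auto
  thus "f i = ereal (real_of_ereal (f i))" .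
  have "(\<Sum>i\<in>UNIV. ereal (real_of_ereal (f i))) = ereal r" using sum by (simp only: real[symmetric])
  thus "(\<Sum>i\<in>UNIV. real_of_ereal (f i)) = r" by (simp only: sum_ereal ereal.inject)
qed

lemma lower_semicontinuous_borel_measurable:
  assumes "lower_semicontinuous f"
  shows "f \<in> borel_measurable borel"
  using assms by (intro borel_measurableI_greater) (auto simp: lower_semicontinuous_def)

lemma ereal_integral_eq_lebesgue_integral:
  assumes g: "integrable M g" and AE_eq: "AE x in M. f x = ereal (g x)"
  shows "ereal_integral M f = ereal (integral\<^sup>L M g)"
proof -
  have e2ennreal_max: "e2ennreal (max 0 (ereal r)) = ennreal r" for r
    by (simp add: max_def ennreal_neg)
  have "(\<integral>\<^sup>+ x. e2ennreal (max 0 (f x)) \<partial>M) = (\<integral>\<^sup>+ x. ennreal (g x) \<partial>M)"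
    by (rule nn_integral_cong_AE) (use AE_eq in eventually_elim, simp add: e2ennreal_max)
  moreover have "(\<integral>\<^sup>+ x. e2ennreal (max 0 (- f x)) \<partial>M) = (\<integral>\<^sup>+ x. ennreal (- g x) \<partial>M)"
    by (rule nn_integral_cong_AE) (use AE_eq in eventually_elim, simp add: e2ennreal_max)
  moreover obtain P N where "(\<integral>\<^sup>+ x. ennreal (g x) \<partial>M) = ennreal P" "P \<ge> 0"
    and "(\<integral>\<^sup>+ x. ennreal (- g x) \<partial>M) = ennreal N" "N \<ge> 0"
    using g unfolding real_integrable_def by (metis ennreal_cases infinity_ennreal_def)
  ultimately show ?thesis
    by (simp add: ereal_integral_def real_lebesgue_integral_def[OF g])
qed

text \<open>The lower bound keeps \<open>f\<close> away from the case \<open>\<infinity> - \<infinity>\<close> in \<^const>\<open>ereal_integral\<close>.\<close>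

lemma ereal_integral_lt_PInfty_imp_integrable:
  fixes f :: "'a \<Rightarrow> ereal"
  assumes [measurable]: "f \<in> borel_measurable M" and b: "integrable M b"
    and lower: "\<And>x. ereal (b x) \<le> f x" and finite: "ereal_integral M f < \<infinity>"
  shows "AE x in M. f x = ereal (real_of_ereal (f x))"
    and "integrable M (\<lambda>x. real_of_ereal (f x))"
proof -
  let ?g = "\<lambda>x. real_of_ereal (f x)"
  have pos: "(\<integral>\<^sup>+ x. e2ennreal (max 0 (f x)) \<partial>M) < \<infinity>"
    using finite unfolding ereal_integral_def by (rule contrapos_pp) (simp add: less_top[symmetric])
  hence "AE x in M. e2ennreal (max 0 (f x)) \<noteq> \<infinity>"
    by (intro nn_integral_PInf_AE) auto
  thus real: "AE x in M. f x = ereal (?g x)"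
  proof eventually_elim
    case (elim x)
    show ?case using lower[of x] elim by (cases "f x") (auto simp: max_def)
  qed
  have "(\<integral>\<^sup>+ x. ennreal (?g x) \<partial>M) \<le> (\<integral>\<^sup>+ x. e2ennreal (max 0 (f x)) \<partial>M)"
  proof (rule nn_integral_mono)
    fix x show "ennreal (?g x) \<le> e2ennreal (max 0 (f x))"
      by (cases "f x") (auto simp: max_def ennreal_neg)
  qed
  hence "(\<integral>\<^sup>+ x. ennreal (?g x) \<partial>M) \<noteq> \<infinity>" using pos by (auto simp: top_unique)
  moreover have "(\<integral>\<^sup>+ x. ennreal (- ?g x) \<partial>M) \<le> (\<integral>\<^sup>+ x. ennreal (norm (b x)) \<partial>M)"
  proof (rule nn_integral_mono)
    fix x show "ennreal (- ?g x) \<le> ennreal (norm (b x))"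
      using lower[of x] by (cases "f x") (auto intro!: ennreal_leI)
  qed
  hence "(\<integral>\<^sup>+ x. ennreal (- ?g x) \<partial>M) \<noteq> \<infinity>"
    using b by (auto simp: integrable_iff_bounded top_unique)
  ultimately show "integrable M ?g" by (simp add: real_integrable_def)
qed

section \<open>Couplings and admissible potentials for a general cost\<close>

definition marginal_couplings ::
  "('i::finite \<Rightarrow> 'a::topological_space measure) \<Rightarrow> ('a ^ 'i) measure set" where
  "marginal_couplings \<mu> =
     {\<gamma>. prob_space \<gamma> \<and> sets \<gamma> = sets borel \<and> (\<forall>i. distr \<gamma> borel (\<lambda>X. X $ i) = \<mu> i)}"

definition admissible :: "('a::topological_space ^ 'i::finite \<Rightarrow> real) \<Rightarrow> ('i \<Rightarrow> 'a \<Rightarrow> ereal) set" where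
  "admissible c = {\<phi>. (\<forall>i. lower_semicontinuous (\<phi> i) \<and> (\<forall>x. \<phi> i x \<noteq> -\<infinity>)) \<and>
                       (\<forall>X. ereal (c X) \<le> (\<Sum>i\<in>UNIV. \<phi> i (X $ i)))}"

lemma admissibleI:
  assumes "\<And>i. lower_semicontinuous (\<phi> i)" "\<And>i x. \<phi> i x \<noteq> -\<infinity>"
    and "\<And>X. ereal (c X) \<le> (\<Sum>i\<in>UNIV. \<phi> i (X $ i))"
  shows "\<phi> \<in> admissible c"
  using assms by (simp add: admissible_def)

lemma admissibleD:
  assumes "\<phi> \<in> admissible c"
  shows "lower_semicontinuous (\<phi> i)" "\<phi> i x \<noteq> -\<infinity>" "ereal (c X) \<le> (\<Sum>i\<in>UNIV. \<phi> i (X $ i))"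
  using assms by (auto simp: admissible_def)

lemma
  assumes \<phi>: "\<phi> \<in> admissible c" and tight: "(\<Sum>i\<in>UNIV. \<phi> i (X $ i)) = ereal r"
  shows potential_eq_real_of_sum_eq_ereal: "\<phi> i (X $ i) = ereal (real_of_ereal (\<phi> i (X $ i)))"
    and potential_lt_PInfty_of_sum_eq_ereal: "\<phi> i (X $ i) < \<infinity>"
    and sum_real_potentials_eq: "(\<Sum>i\<in>UNIV. real_of_ereal (\<phi> i (X $ i))) = r"
proof -
  show real: "\<phi> i (X $ i) = ereal (real_of_ereal (\<phi> i (X $ i)))" for i
    by (rule sum_eq_ereal_imp_real[OF tight admissibleD(2)[OF \<phi>]])
  show "\<phi> i (X $ i) < \<infinity>" by (subst real) simp
  show "(\<Sum>i\<in>UNIV. real_of_ereal (\<phi> i (X $ i))) = r"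
    by (rule sum_real_of_ereal_eq[OF tight admissibleD(2)[OF \<phi>]])
qed

definition vec_upd :: "'a ^ 'i \<Rightarrow> 'i \<Rightarrow> 'a \<Rightarrow> 'a ^ 'i" where
  "vec_upd X i a = (\<chi> j. if j = i then a else X $ j)"

lemma vec_upd_nth [simp]: "vec_upd X i a $ j = (if j = i then a else X $ j)"
  by (simp add: vec_upd_def)

lemma vec_upd_nth_self [simp]: "vec_upd X i (X $ i) = X"
  by (simp add: vec_eq_iff)

lemma vec_upd_vec_upd [simp]: "vec_upd (vec_upd X i a) i b = vec_upd X i b"
  by (simp add: vec_eq_iff)

lemma sum_vec_upd:
  fixes f :: "'i::finite \<Rightarrow> 'a \<Rightarrow> 'b::comm_monoid_add"
  shows "(\<Sum>j\<in>UNIV. f j (vec_upd X i a $ j)) = f i a + (\<Sum>j\<in>UNIV-{i}. f j (X $ j))"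
  by (subst sum.remove[of _ i]) (auto intro!: arg_cong2[where f = plus] sum.cong)

lemma continuous_on_vec_upd [continuous_intros]:
  fixes X :: "'b::topological_space \<Rightarrow> 'a::topological_space ^ 'i::finite"
  assumes "continuous_on S X" "continuous_on S f"
  shows "continuous_on S (\<lambda>t. vec_upd (X t) i (f t))"
  unfolding vec_upd_def
proof (rule continuous_on_vec_lambda)
  fix j show "continuous_on S (\<lambda>t. if j = i then f t else X t $ j)"
    using assms by (cases "j = i") (simp_all add: continuous_on_component)
qed

section \<open>Conjugate potentials\<close>

definition conj_potential ::
    "('a ^ 'i::finite \<Rightarrow> real) \<Rightarrow> ('i \<Rightarrow> 'a \<Rightarrow> ereal) \<Rightarrow> 'i \<Rightarrow> 'a \<Rightarrow> ereal" where
  "conj_potential c \<phi> i x =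
     (SUP X \<in> {X. X $ i = x}. ereal (c X) - (\<Sum>j\<in>UNIV - {i}. \<phi> j (X $ j)))"

lemma conj_potential_eq_SUP_vec_upd:
  fixes c :: "'a ^ 'i::finite \<Rightarrow> real"
  shows "conj_potential c \<phi> i x = (SUP X. ereal (c (vec_upd X i x)) - (\<Sum>j\<in>UNIV-{i}. \<phi> j (X $ j)))"
proof -
  have "X = vec_upd X i x" if "X $ i = x" for X :: "'a ^ 'i" using that by auto
  hence "{X. X $ i = x} = range (\<lambda>X. vec_upd X i x)" by auto
  moreover have "(\<Sum>j\<in>UNIV-{i}. \<phi> j (vec_upd X i x $ j)) = (\<Sum>j\<in>UNIV-{i}. \<phi> j (X $ j))" for X
    by (intro sum.cong) auto
  ultimately show ?thesis by (simp add: conj_potential_def image_image)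
qed

lemma conj_potential_fun_upd_self: "conj_potential c (\<phi>(i := f)) i = conj_potential c \<phi> i"
  unfolding conj_potential_def by (intro ext SUP_cong refl arg_cong2[where f = minus] sum.cong) auto

lemma conj_potential_antimono:
  assumes "\<And>j x. \<psi> j x \<le> \<phi> j x"
  shows "conj_potential c \<phi> i x \<le> conj_potential c \<psi> i x"
  unfolding conj_potential_def
  by (intro SUP_mono' ereal_minus_mono sum_mono assms order_refl)

lemma conj_potential_le:
  assumes \<phi>: "\<phi> \<in> admissible c"
  shows "conj_potential c \<phi> i x \<le> \<phi> i x"
  unfolding conj_potential_eq_SUP_vec_upd
proof (rule SUP_least)
  fix X
  let ?s = "\<Sum>j\<in>UNIV-{i}. \<phi> j (X $ j)"
  have "ereal (c (vec_upd X i x)) \<le> \<phi> i x + ?s"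
    using admissibleD(3)[OF \<phi>, of "vec_upd X i x"] by (simp only: sum_vec_upd)
  moreover have "?s \<noteq> -\<infinity>" by (intro sum_ereal_neq_MInfty admissibleD(2)[OF \<phi>])
  ultimately show "ereal (c (vec_upd X i x)) - ?s \<le> \<phi> i x"
    by (cases ?s; cases "\<phi> i x") auto
qed

lemma lower_semicontinuous_conj_potential:
  fixes c :: "'a::topological_space ^ 'i::finite \<Rightarrow> real"
  assumes cont: "continuous_on UNIV c" and neq: "\<And>j x. \<phi> j x \<noteq> -\<infinity>"
  shows "lower_semicontinuous (conj_potential c \<phi> i)"
  unfolding lower_semicontinuous_def
proof
  fix t
  let ?s = "\<lambda>X. \<Sum>j\<in>UNIV-{i}. \<phi> j (X $ j)"
  have "open {x. t < ereal (c (vec_upd X i x)) - ?s X}" for X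
  proof (cases "?s X")
    case (real s)
    have "continuous_on UNIV (\<lambda>x. c (vec_upd X i x))"
      by (rule continuous_on_compose2[OF cont])
         (intro continuous_on_vec_upd continuous_on_const continuous_on_id, simp)
    hence "continuous_on UNIV (\<lambda>x. ereal (c (vec_upd X i x) - s))"
      by (intro continuous_intros)
    thus ?thesis unfolding real by (simp add: open_Collect_less)
  next
    case MInf
    moreover have "?s X \<noteq> -\<infinity>" by (intro sum_ereal_neq_MInfty neq)
    ultimately show ?thesis by simp
  qed auto
  moreover have "{x. t < conj_potential c \<phi> i x} = (\<Union>X. {x. t < ereal (c (vec_upd X i x)) - ?s X})"
    by (auto simp: conj_potential_eq_SUP_vec_upd less_SUP_iff)
  ultimately show "open {x. t < conj_potential c \<phi> i x}" by auto
qed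

lemma admissible_fun_upd_conj_potential:
  fixes c :: "'a::topological_space ^ 'i::finite \<Rightarrow> real"
  assumes cont: "continuous_on UNIV c" and \<phi>: "\<phi> \<in> admissible c" and X0: "\<And>j. \<phi> j (X0 $ j) < \<infinity>"
  shows "\<phi>(i := conj_potential c \<phi> i) \<in> admissible c"
proof (rule admissibleI)
  let ?s = "\<lambda>X. \<Sum>j\<in>UNIV-{i}. \<phi> j (X $ j)"
  have s_neq: "?s X \<noteq> -\<infinity>" for X by (intro sum_ereal_neq_MInfty admissibleD(2)[OF \<phi>])
  have upper: "ereal (c (vec_upd X i x)) - ?s X \<le> conj_potential c \<phi> i x" for X x
    unfolding conj_potential_eq_SUP_vec_upd by (rule SUP_upper) simp
  have "?s X0 \<noteq> \<infinity>" using X0 by (auto simp: sum_Pinfty)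
  hence neq: "conj_potential c \<phi> i x \<noteq> -\<infinity>" for x
    using upper[of X0 x] s_neq[of X0] by (cases "?s X0") auto
  show "lower_semicontinuous ((\<phi>(i := conj_potential c \<phi> i)) j)" for j
    using lower_semicontinuous_conj_potential[OF cont] admissibleD(1,2)[OF \<phi>] by simp
  show "(\<phi>(i := conj_potential c \<phi> i)) j x \<noteq> -\<infinity>" for j x
    using neq admissibleD(2)[OF \<phi>] by simp
  show "ereal (c X) \<le> (\<Sum>j\<in>UNIV. (\<phi>(i := conj_potential c \<phi> i)) j (X $ j))" for X
  proof -
    have "ereal (c X) \<le> conj_potential c \<phi> i (X $ i) + ?s X"
      using upper[of X "X $ i"] neq[of "X $ i"] s_neq[of X]
      by (cases "?s X"; cases "conj_potential c \<phi> i (X $ i)") auto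
    also have "\<dots> = (\<Sum>j\<in>UNIV. (\<phi>(i := conj_potential c \<phi> i)) j (X $ j))"
      by (subst sum.remove[of UNIV i]) auto
    finally show ?thesis .
  qed
qed

text \<open>Replacing one potential by its conjugate lowers it, hence raises the conjugates of the others;
  since these are bounded by the potentials anyway, coordinates that were already conjugate stay so.\<close>

lemma ex_conjugate_potentials:
  fixes c :: "'a::topological_space ^ 'i::finite \<Rightarrow> real"
  assumes cont: "continuous_on UNIV c" and \<phi>: "\<phi> \<in> admissible c" and X0: "\<And>j. \<phi> j (X0 $ j) < \<infinity>"
  shows "\<exists>\<psi>\<in>admissible c. (\<forall>i x. \<psi> i x \<le> \<phi> i x) \<and> (\<forall>i. \<psi> i = conj_potential c \<psi> i)"
proof -
  have "\<exists>\<psi>\<in>admissible c. (\<forall>i x. \<psi> i x \<le> \<phi> i x) \<and> (\<forall>i\<in>A. \<psi> i = conj_potential c \<psi> i)"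
    if "finite A" for A
    using that
  proof (induction A)
    case empty
    show ?case using \<phi> by auto
  next
    case (insert k A)
    then obtain \<psi> where \<psi>: "\<psi> \<in> admissible c" and \<psi>_le: "\<And>i x. \<psi> i x \<le> \<phi> i x"
      and conj: "\<And>i. i \<in> A \<Longrightarrow> \<psi> i = conj_potential c \<psi> i" by blast
    let ?\<psi> = "\<psi>(k := conj_potential c \<psi> k)"
    have \<psi>_upd: "?\<psi> \<in> admissible c"
      using le_less_trans[OF \<psi>_le X0] by (rule admissible_fun_upd_conj_potential[OF cont \<psi>])
    have upd_le: "?\<psi> i x \<le> \<psi> i x" for i x using conj_potential_le[OF \<psi>] by simp
    have "?\<psi> i = conj_potential c ?\<psi> i" if "i \<in> insert k A" for i
    proof (cases "i = k")
      case False
      hence "?\<psi> i x = conj_potential c \<psi> i x" for x using conj[of i] that by simp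
      hence "?\<psi> i x \<le> conj_potential c ?\<psi> i x" for x
        using conj_potential_antimono[of ?\<psi> \<psi> c i x] upd_le by simp
      thus ?thesis using conj_potential_le[OF \<psi>_upd] by (intro ext antisym)
    qed (simp add: conj_potential_fun_upd_self)
    thus ?case using \<psi>_upd order_trans[OF upd_le \<psi>_le] by blast
  qed
  from this[of UNIV] show ?thesis by simp
qed

section \<open>Weak duality and complementary slackness\<close>

lemma borel_measurable_vec_nth [measurable]:
  "(\<lambda>X :: 'a::topological_space ^ 'i::finite. X $ i) \<in> borel_measurable borel"
  by (intro borel_measurable_continuous_onI continuous_intros)

context
  fixes \<mu> :: "'i::finite \<Rightarrow> 'a::topological_space measure" and \<gamma> :: "('a ^ 'i) measure"
  assumes coupling: "\<gamma> \<in> marginal_couplings \<mu>"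
begin

lemma prob_space_coupling: "prob_space \<gamma>"
  using coupling by (simp add: marginal_couplings_def)

lemma sets_coupling [measurable_cong]: "sets \<gamma> = sets borel"
  using coupling by (simp add: marginal_couplings_def)

lemma distr_coupling: "distr \<gamma> borel (\<lambda>X. X $ i) = \<mu> i"
  using coupling by (simp add: marginal_couplings_def)

lemma measurable_coupling_nth [measurable]: "(\<lambda>X. X $ i) \<in> measurable \<gamma> borel"
  by measurable

lemma sets_marginal_of_coupling: "sets (\<mu> i) = sets borel"
  unfolding distr_coupling[symmetric, of i] by simp

lemma
  fixes f :: "'a \<Rightarrow> real"
  assumes "integrable (\<mu> i) f"
  shows integrable_coupling_nth: "integrable \<gamma> (\<lambda>X. f (X $ i))"
    and integral_coupling_nth: "(\<integral>X. f (X $ i) \<partial>\<gamma>) = integral\<^sup>L (\<mu> i) f"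
proof -
  have [measurable]: "f \<in> borel_measurable borel"
    using borel_measurable_integrable[OF assms]
    by (simp add: measurable_cong_sets[OF sets_marginal_of_coupling refl])
  show "integrable \<gamma> (\<lambda>X. f (X $ i))"
    using assms
    by (subst integrable_distr_eq[symmetric, where N = borel]) (auto simp: distr_coupling)
  show "(\<integral>X. f (X $ i) \<partial>\<gamma>) = integral\<^sup>L (\<mu> i) f"
    by (subst integral_distr[symmetric, where N = borel]) (auto simp: distr_coupling)
qed

lemma AE_coupling_nth:
  assumes "AE x in \<mu> i. P x"
  shows "AE X in \<gamma>. P (X $ i)"
  using assms unfolding distr_coupling[symmetric, of i]
  by (rule AE_distrD[OF measurable_coupling_nth])

lemma sum_ereal_integral_eq_integral_coupling:
  assumes "\<And>i. integrable (\<mu> i) (g i)" and "\<And>i. AE x in \<mu> i. \<phi> i x = ereal (g i x)"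
  shows "(\<Sum>i\<in>UNIV. ereal_integral (\<mu> i) (\<phi> i)) = ereal (\<integral>X. (\<Sum>i\<in>UNIV. g i (X $ i)) \<partial>\<gamma>)"
  using assms
  by (simp add: ereal_integral_eq_lebesgue_integral[OF assms] integrable_coupling_nth
      integral_coupling_nth)

end

lemma abs_le_abs_sum_plus_lower_bounds:
  fixes g l :: "'i::finite \<Rightarrow> real"
  assumes lower: "\<And>j. l j \<le> g j"
  shows "\<bar>g i\<bar> \<le> \<bar>sum g UNIV\<bar> + (\<Sum>j\<in>UNIV. \<bar>l j\<bar>)"
proof -
  have "\<bar>l i\<bar> \<le> (\<Sum>j\<in>UNIV. \<bar>l j\<bar>)" by (rule member_le_sum) auto
  moreover have "(\<Sum>j\<in>UNIV-{i}. l j) \<le> (\<Sum>j\<in>UNIV-{i}. g j)" by (rule sum_mono) (rule lower)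
  moreover have "- (\<Sum>j\<in>UNIV-{i}. l j) \<le> (\<Sum>j\<in>UNIV-{i}. \<bar>l j\<bar>)"
    unfolding sum_negf[symmetric] by (rule sum_mono) simp
  moreover have "(\<Sum>j\<in>UNIV-{i}. \<bar>l j\<bar>) \<le> (\<Sum>j\<in>UNIV. \<bar>l j\<bar>)" by (rule sum_mono2) auto
  moreover have "sum g UNIV = g i + (\<Sum>j\<in>UNIV-{i}. g j)" by (rule sum.remove) auto
  ultimately show ?thesis using lower[of i] by linarith
qed

locale multimarginal =
  fixes \<mu> :: "'i::finite \<Rightarrow> 'a::topological_space measure" and c :: "'a ^ 'i \<Rightarrow> real"
    and b :: "'i \<Rightarrow> 'a \<Rightarrow> real"
  assumes prob_space_marginal: "\<And>i. prob_space (\<mu> i)"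
    and sets_marginal_borel: "\<And>i. sets (\<mu> i) = sets borel"
    and continuous_cost: "continuous_on UNIV c"
    and integrable_bound: "\<And>i. integrable (\<mu> i) (b i)"
    and abs_cost_le: "\<And>X. \<bar>c X\<bar> \<le> (\<Sum>i\<in>UNIV. b i (X $ i))"
begin

lemma measurable_marginal: "measurable (\<mu> i) N = measurable borel N"
  by (rule measurable_cong_sets) (auto simp: sets_marginal_borel)

lemma borel_measurable_cost [measurable]: "c \<in> borel_measurable borel"
  by (rule borel_measurable_continuous_onI[OF continuous_cost])

lemma borel_measurable_admissible:
  assumes "\<phi> \<in> admissible c"
  shows "\<phi> i \<in> borel_measurable borel"
  using admissibleD(1)[OF assms] by (rule lower_semicontinuous_borel_measurable)

lemma integrable_bound_const: "integrable (\<mu> i) (\<lambda>x. - b i x - C)"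
proof -
  interpret prob_space "\<mu> i" by (rule prob_space_marginal)
  show ?thesis using integrable_bound[of i] by simp
qed

lemma integrable_cost:
  assumes \<gamma>: "\<gamma> \<in> marginal_couplings \<mu>"
  shows "integrable \<gamma> c"
proof (rule Bochner_Integration.integrable_bound)
  show "integrable \<gamma> (\<lambda>X. \<Sum>i\<in>UNIV. b i (X $ i))"
    by (intro Bochner_Integration.integrable_sum integrable_coupling_nth[OF \<gamma>] integrable_bound)
  show "c \<in> borel_measurable \<gamma>"
    by (simp add: measurable_cong_sets[OF sets_coupling[OF \<gamma>] refl])
  show "AE X in \<gamma>. norm (c X) \<le> norm (\<Sum>i\<in>UNIV. b i (X $ i))"
    using abs_cost_le by (auto intro: order_trans[OF _ abs_ge_self])
qed

lemma admissible_lower_bound: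
  assumes \<phi>: "\<phi> \<in> admissible c" and X0: "\<And>i. \<phi> i (X0 $ i) < \<infinity>"
  shows "\<exists>C. \<forall>i x. ereal (- b i x - C) \<le> \<phi> i x"
proof (intro exI allI)
  define v where "v = (\<lambda>i. real_of_ereal (\<phi> i (X0 $ i)))"
  have v: "\<phi> i (X0 $ i) = ereal (v i)" for i
    using X0[of i] admissibleD(2)[OF \<phi>] by (cases "\<phi> i (X0 $ i)") (auto simp: v_def)
  let ?C = "\<Sum>j\<in>UNIV. \<bar>b j (X0 $ j)\<bar> + \<bar>v j\<bar>"
  fix i x
  let ?X = "vec_upd X0 i x"
  have "ereal (c ?X) \<le> \<phi> i x + (\<Sum>j\<in>UNIV-{i}. \<phi> j (X0 $ j))"
    using admissibleD(3)[OF \<phi>, of ?X] by (simp only: sum_vec_upd)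
  hence "ereal (c ?X - (\<Sum>j\<in>UNIV-{i}. v j)) \<le> \<phi> i x"
    by (cases "\<phi> i x") (auto simp: v)
  moreover have "- c ?X \<le> b i x + (\<Sum>j\<in>UNIV-{i}. b j (X0 $ j))"
    using abs_cost_le[of ?X] by (simp only: sum_vec_upd)
  moreover have "(\<Sum>j\<in>UNIV-{i}. b j (X0 $ j)) + (\<Sum>j\<in>UNIV-{i}. v j) \<le> ?C"
  proof -
    have "(\<Sum>j\<in>UNIV-{i}. b j (X0 $ j) + v j) \<le> (\<Sum>j\<in>UNIV-{i}. \<bar>b j (X0 $ j)\<bar> + \<bar>v j\<bar>)"
      by (intro sum_mono add_mono abs_ge_self)
    also have "\<dots> \<le> ?C" by (rule sum_mono2) auto
    finally show ?thesis by (simp add: sum.distrib)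
  qed
  ultimately show "ereal (- b i x - ?C) \<le> \<phi> i x"
    by (elim order_trans[rotated]) simp
qed

lemma
  assumes \<psi>: "\<psi> \<in> admissible c" and finite: "\<And>i. ereal_integral (\<mu> i) (\<psi> i) < \<infinity>"
  shows AE_admissible_eq_real: "AE x in \<mu> i. \<psi> i x = ereal (real_of_ereal (\<psi> i x))"
    and integrable_admissible: "integrable (\<mu> i) (\<lambda>x. real_of_ereal (\<psi> i x))"
proof -
  have "\<exists>x. \<psi> i x < \<infinity>" for i
  proof (rule ccontr)
    assume "\<not> ?thesis"
    hence "\<psi> i = (\<lambda>_. \<infinity>)" by (auto simp: not_less)
    moreover have "emeasure (\<mu> i) (space (\<mu> i)) = 1"
      by (rule prob_space.emeasure_space_1[OF prob_space_marginal])
    ultimately show False using finite[of i] by (simp add: ereal_integral_def)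
  qed
  then obtain x0 where "\<And>i. \<psi> i (x0 i) < \<infinity>" by metis
  hence X0: "\<psi> i ((\<chi> i. x0 i) $ i) < \<infinity>" for i by simp
  obtain C where lower: "\<And>i x. ereal (- b i x - C) \<le> \<psi> i x"
    using admissible_lower_bound[OF \<psi> X0] by blast
  have meas: "\<psi> i \<in> borel_measurable (\<mu> i)"
    unfolding measurable_marginal by (rule borel_measurable_admissible[OF \<psi>])
  note real = ereal_integral_lt_PInfty_imp_integrable[OF meas integrable_bound_const lower finite]
  show "AE x in \<mu> i. \<psi> i x = ereal (real_of_ereal (\<psi> i x))" by (rule real)
  show "integrable (\<mu> i) (\<lambda>x. real_of_ereal (\<psi> i x))" by (rule real)
qed

lemma weak_duality:
  assumes \<gamma>: "\<gamma> \<in> marginal_couplings \<mu>" and \<psi>: "\<psi> \<in> admissible c"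
  shows "ereal (integral\<^sup>L \<gamma> c) \<le> (\<Sum>i\<in>UNIV. ereal_integral (\<mu> i) (\<psi> i))"
proof (cases "\<exists>i. ereal_integral (\<mu> i) (\<psi> i) = \<infinity>")
  case True
  hence "(\<Sum>i\<in>UNIV. ereal_integral (\<mu> i) (\<psi> i)) = \<infinity>" by (auto simp: sum_Pinfty)
  thus ?thesis by simp
next
  case False
  hence finite: "ereal_integral (\<mu> i) (\<psi> i) < \<infinity>" for i by simp
  note real = AE_admissible_eq_real[OF \<psi> finite] and int = integrable_admissible[OF \<psi> finite]
  let ?g = "\<lambda>i x. real_of_ereal (\<psi> i x)"
  have "integral\<^sup>L \<gamma> c \<le> (\<integral>X. (\<Sum>i\<in>UNIV. ?g i (X $ i)) \<partial>\<gamma>)"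
  proof (rule integral_mono_AE)
    show "integrable \<gamma> (\<lambda>X. \<Sum>i\<in>UNIV. ?g i (X $ i))"
      by (intro Bochner_Integration.integrable_sum integrable_coupling_nth[OF \<gamma>] int)
    have "AE X in \<gamma>. \<forall>i. \<psi> i (X $ i) = ereal (?g i (X $ i))"
      using AE_coupling_nth[OF \<gamma> real] by (simp add: AE_all_countable)
    thus "AE X in \<gamma>. c X \<le> (\<Sum>i\<in>UNIV. ?g i (X $ i))"
    proof eventually_elim
      case (elim X)
      have "ereal (c X) \<le> (\<Sum>i\<in>UNIV. ereal (?g i (X $ i)))"
        using admissibleD(3)[OF \<psi>, of X] by (simp only: elim[rule_format, symmetric])
      thus ?case by simp
    qed
  qed (rule integrable_cost[OF \<gamma>])
  thus ?thesis by (simp add: sum_ereal_integral_eq_integral_coupling[OF \<gamma> int real])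
qed

lemma integrable_tight_potential:
  assumes \<gamma>: "\<gamma> \<in> marginal_couplings \<mu>" and \<phi>: "\<phi> \<in> admissible c"
    and tight: "AE X in \<gamma>. (\<Sum>i\<in>UNIV. \<phi> i (X $ i)) = ereal (c X)"
  shows "integrable \<gamma> (\<lambda>X. real_of_ereal (\<phi> i (X $ i)))"
proof -
  let ?g = "\<lambda>i x. real_of_ereal (\<phi> i x)"
  interpret prob_space \<gamma> by (rule prob_space_coupling[OF \<gamma>])
  note [measurable] = borel_measurable_admissible[OF \<phi>] measurable_coupling_nth[OF \<gamma>]
  obtain X0 where "(\<Sum>i\<in>UNIV. \<phi> i (X0 $ i)) = ereal (c X0)"
    using eventually_happens'[OF ae_filter_bot tight] by blast
  then obtain C where lower: "\<And>i x. ereal (- b i x - C) \<le> \<phi> i x"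
    using admissible_lower_bound[OF \<phi>] potential_lt_PInfty_of_sum_eq_ereal[OF \<phi>] by meson
  let ?bound = "\<lambda>X. \<bar>c X\<bar> + (\<Sum>j\<in>UNIV. \<bar>- b j (X $ j) - C\<bar>)"
  have "integrable \<gamma> ?bound"
    by (intro Bochner_Integration.integrable_add Bochner_Integration.integrable_sum integrable_abs
        integrable_cost[OF \<gamma>] integrable_coupling_nth[OF \<gamma> integrable_bound_const])
  moreover have "(\<lambda>X. ?g i (X $ i)) \<in> borel_measurable \<gamma>" by measurable
  moreover have "AE X in \<gamma>. norm (?g i (X $ i)) \<le> norm (?bound X)"
    using tight
  proof eventually_elim
    case (elim X)
    have "- b j (X $ j) - C \<le> ?g j (X $ j)" for j
      using lower[of j "X $ j"] potential_eq_real_of_sum_eq_ereal[OF \<phi> elim, of j]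
      by (metis ereal_less_eq(3))
    from abs_le_abs_sum_plus_lower_bounds[where g = "\<lambda>j. ?g j (X $ j)", OF this, of i]
    show ?case using sum_real_potentials_eq[OF \<phi> elim] by simp
  qed
  ultimately show ?thesis by (rule Bochner_Integration.integrable_bound)
qed

lemma complementary_slackness:
  assumes \<gamma>: "\<gamma> \<in> marginal_couplings \<mu>" and \<phi>: "\<phi> \<in> admissible c"
    and tight: "AE X in \<gamma>. (\<Sum>i\<in>UNIV. \<phi> i (X $ i)) = ereal (c X)"
  shows "(\<Sum>i\<in>UNIV. ereal_integral (\<mu> i) (\<phi> i)) = ereal (integral\<^sup>L \<gamma> c)"
proof -
  note [measurable] = borel_measurable_admissible[OF \<phi>] measurable_coupling_nth[OF \<gamma>]
    borel_measurable_integrable[OF integrable_cost[OF \<gamma>]]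
  let ?g = "\<lambda>i x. real_of_ereal (\<phi> i x)"
  have g_int: "integrable (\<mu> i) (?g i)" for i
    using integrable_tight_potential[OF \<gamma> \<phi> tight]
    unfolding distr_coupling[OF \<gamma>, symmetric, of i] by (subst integrable_distr_eq) auto
  have "AE X in \<gamma>. \<phi> i (X $ i) = ereal (?g i (X $ i))" for i
    using tight by eventually_elim (rule potential_eq_real_of_sum_eq_ereal[OF \<phi>])
  hence g_eq: "AE x in \<mu> i. \<phi> i x = ereal (?g i x)" for i
    unfolding distr_coupling[OF \<gamma>, symmetric, of i] by (subst AE_distr_iff) auto
  have "AE X in \<gamma>. (\<Sum>i\<in>UNIV. ?g i (X $ i)) = c X"
    using tight by eventually_elim (rule sum_real_potentials_eq[OF \<phi>])
  hence "(\<integral>X. (\<Sum>i\<in>UNIV. ?g i (X $ i)) \<partial>\<gamma>) = integral\<^sup>L \<gamma> c"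
    by (intro integral_cong_AE) measurable
  thus ?thesis by (simp add: sum_ereal_integral_eq_integral_coupling[OF \<gamma> g_int g_eq])
qed

end

section \<open>Approximate duality for finitely supported marginals\<close>

definition Pi_vec :: "('i \<Rightarrow> 'a set) \<Rightarrow> ('a ^ 'i) set" where
  "Pi_vec S = {X. \<forall>i. X $ i \<in> S i}"

lemma mem_Pi_vec [simp]: "X \<in> Pi_vec S \<longleftrightarrow> (\<forall>i. X $ i \<in> S i)"
  by (simp add: Pi_vec_def)

lemma finite_Pi_vec:
  fixes S :: "'i::finite \<Rightarrow> 'a set"
  assumes "\<And>i. finite (S i)"
  shows "finite (Pi_vec S)"
proof (rule finite_surj)
  show "finite (PiE UNIV S)" using assms by (intro finite_PiE) auto
  show "Pi_vec S \<subseteq> vec_lambda ` PiE UNIV S"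
  proof
    fix X assume "X \<in> Pi_vec S"
    hence "vec_nth X \<in> PiE UNIV S" by auto
    thus "X \<in> vec_lambda ` PiE UNIV S" by (metis image_eqI vec_nth_inverse)
  qed
qed

lemma swap_invariant_imp_separable:
  fixes G :: "'a ^ 'i::finite \<Rightarrow> real"
  assumes swap: "\<And>X Y i. X \<in> Pi_vec S \<Longrightarrow> Y \<in> Pi_vec S \<Longrightarrow>
      G X + G Y = G (vec_upd X i (Y $ i)) + G (vec_upd Y i (X $ i))"
  shows "\<exists>\<phi>. \<forall>X\<in>Pi_vec S. G X = (\<Sum>i\<in>UNIV. \<phi> i (X $ i))"
proof (cases "Pi_vec S = {}")
  case False
  then obtain Z where Z: "Z \<in> Pi_vec S" by blast
  have telescope:
    "G (\<chi> i. if i \<in> A then X $ i else Z $ i) = G Z + (\<Sum>i\<in>A. G (vec_upd Z i (X $ i)) - G Z)"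
    if X: "X \<in> Pi_vec S" and "finite A" for X A
    using \<open>finite A\<close>
  proof (induction A)
    case (insert k A)
    let ?M = "\<chi> i. if i \<in> A then X $ i else Z $ i"
    have "G ?M + G (vec_upd Z k (X $ k)) = G (vec_upd ?M k (X $ k)) + G Z"
      using swap[of ?M "vec_upd Z k (X $ k)" k] X Z insert.hyps by simp
    moreover have "(\<chi> i. if i \<in> insert k A then X $ i else Z $ i) = vec_upd ?M k (X $ k)"
      by (simp add: vec_eq_iff)
    ultimately show ?case using insert by (simp add: algebra_simps)
  qed (simp add: vec_nth_inverse)
  define \<phi> where "\<phi> = (\<lambda>i a. G (vec_upd Z i a) - G Z + G Z / CARD('i))"
  have "G X = (\<Sum>i\<in>UNIV. \<phi> i (X $ i))" if "X \<in> Pi_vec S" for X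
    using telescope[OF that, of UNIV] by (simp add: \<phi>_def sum.distrib vec_nth_inverse)
  thus ?thesis by blast
qed auto

lemma ex_pmf_of_weights:
  assumes "finite S" "\<And>x. 0 \<le> w x" "\<And>x. x \<notin> S \<Longrightarrow> w x = 0" "sum w S = 1"
  shows "\<exists>p. pmf p = w"
proof -
  have "(\<integral>\<^sup>+ x. ennreal (w x) \<partial>count_space UNIV) = 1"
    using assms by (subst nn_integral_count_space'[of S]) auto
  hence "pmf (embed_pmf w) x = w x" for x
    using assms(2) by (intro pmf_embed_pmf) auto
  thus ?thesis by blast
qed

lemma compact_PiE_UNIV:
  fixes A :: "'i \<Rightarrow> 'b::topological_space set"
  assumes "\<And>i. compact (A i)"
  shows "compact (PiE UNIV A)"
proof -
  have "compactin (product_topology (\<lambda>_. euclidean) UNIV) (PiE UNIV A)"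
    using assms by (simp add: compactin_PiE)
  thus ?thesis by (simp add: euclidean_product_topology)
qed

definition pmf_couplings :: "('i::finite \<Rightarrow> 'a pmf) \<Rightarrow> ('a ^ 'i) pmf set" where
  "pmf_couplings m = {\<gamma>. \<forall>i. map_pmf (\<lambda>X. X $ i) \<gamma> = m i}"

lemma pmf_coupling_nth: "\<gamma> \<in> pmf_couplings m \<Longrightarrow> map_pmf (\<lambda>X. X $ i) \<gamma> = m i"
  by (simp add: pmf_couplings_def)

lemma set_pmf_coupling:
  assumes "\<gamma> \<in> pmf_couplings m"
  shows "set_pmf \<gamma> \<subseteq> Pi_vec (\<lambda>i. set_pmf (m i))"
  by (auto simp: pmf_coupling_nth[OF assms, symmetric])

locale finite_marginals =
  fixes m :: "'i::finite \<Rightarrow> 'a pmf"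
  assumes finite_set_pmf: "\<And>i. finite (set_pmf (m i))"
begin

definition grid :: "('a ^ 'i) set" where
  "grid = Pi_vec (\<lambda>i. set_pmf (m i))"

definition slice :: "'i \<Rightarrow> 'a \<Rightarrow> ('a ^ 'i) set" where
  "slice i a = {X \<in> grid. X $ i = a}"

definition weights :: "('a ^ 'i \<Rightarrow> real) set" where
  "weights = {g. (\<forall>X. 0 \<le> g X) \<and> (\<forall>X. X \<notin> grid \<longrightarrow> g X = 0) \<and>
                 (\<forall>i. \<forall>a\<in>set_pmf (m i). sum g (slice i a) = pmf (m i) a)}"

lemma finite_grid: "finite grid"
  unfolding grid_def by (intro finite_Pi_vec finite_set_pmf)

lemma finite_slice: "finite (slice i a)"
  using finite_grid by (simp add: slice_def)

lemma pmf_coupling_in_weights: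
  assumes "\<gamma> \<in> pmf_couplings m"
  shows "pmf \<gamma> \<in> weights"
proof -
  have supp: "set_pmf \<gamma> \<subseteq> grid" using set_pmf_coupling[OF assms] by (simp add: grid_def)
  have "sum (pmf \<gamma>) (slice i a) = pmf (m i) a" for i a
  proof -
    have "pmf (m i) a = measure \<gamma> {X. X $ i = a}"
      unfolding pmf_coupling_nth[OF assms, symmetric, of i] pmf_map by (simp add: vimage_def)
    also have "\<dots> = measure \<gamma> (slice i a)"
      by (rule measure_pmf.finite_measure_eq_AE)
         (use supp in \<open>auto simp: AE_measure_pmf_iff slice_def\<close>)
    finally show ?thesis by (simp add: measure_measure_pmf_finite finite_slice)
  qed
  thus ?thesis using supp by (auto simp: weights_def pmf_eq_0_set_pmf)
qed

lemma sum_weights: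
  assumes "g \<in> weights"
  shows "sum g grid = 1"
proof -
  fix i :: 'i
  have "grid = (\<Union>a\<in>set_pmf (m i). slice i a)" by (auto simp: grid_def slice_def)
  also have "sum g \<dots> = (\<Sum>a\<in>set_pmf (m i). sum g (slice i a))"
    by (rule sum.UNION_disjoint) (auto simp: finite_set_pmf finite_slice, auto simp: slice_def)
  also have "\<dots> = (\<Sum>a\<in>set_pmf (m i). pmf (m i) a)"
    by (rule sum.cong) (use assms in \<open>auto simp: weights_def\<close>)
  also have "\<dots> = 1" by (rule sum_pmf_eq_1) (auto simp: finite_set_pmf)
  finally show ?thesis .
qed

lemma ex_pmf_coupling_of_weights:
  assumes g: "g \<in> weights"
  shows "\<exists>\<gamma>\<in>pmf_couplings m. pmf \<gamma> = g"
proof -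
  obtain \<gamma> where \<gamma>: "pmf \<gamma> = g"
    using ex_pmf_of_weights[of grid g] finite_grid sum_weights[OF g] g by (auto simp: weights_def)
  have supp: "set_pmf \<gamma> \<subseteq> grid" using g by (auto simp: weights_def set_pmf_eq \<gamma>)
  have "pmf (map_pmf (\<lambda>X. X $ i) \<gamma>) a = pmf (m i) a" for i a
  proof -
    have "pmf (map_pmf (\<lambda>X. X $ i) \<gamma>) a = measure \<gamma> (slice i a)"
      unfolding pmf_map
      by (rule measure_pmf.finite_measure_eq_AE)
         (use supp in \<open>auto simp: AE_measure_pmf_iff slice_def\<close>)
    also have "\<dots> = sum g (slice i a)" by (simp add: measure_measure_pmf_finite finite_slice \<gamma>)
    also have "\<dots> = pmf (m i) a"
    proof (cases "a \<in> set_pmf (m i)")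
      case False
      hence "slice i a = {}" by (auto simp: slice_def grid_def)
      thus ?thesis using False by (simp add: pmf_eq_0_set_pmf)
    qed (use g in \<open>auto simp: weights_def\<close>)
    finally show ?thesis .
  qed
  thus ?thesis using \<gamma> by (auto simp: pmf_couplings_def intro!: pmf_eqI)
qed

lemma weights_le_1: "g \<in> weights \<Longrightarrow> g X \<le> 1"
  using ex_pmf_coupling_of_weights pmf_le_1 by metis

lemma compact_weights: "compact weights"
proof -
  let ?box = "PiE UNIV (\<lambda>X. if X \<in> grid then {0..1::real} else {0})"
  have "weights = ?box \<inter> (\<Inter>i. \<Inter>a\<in>set_pmf (m i). {g. sum g (slice i a) = pmf (m i) a})"
  proof (intro equalityI subsetI)
    fix g assume g: "g \<in> weights"
    thus "g \<in> ?box \<inter> (\<Inter>i. \<Inter>a\<in>set_pmf (m i). {g. sum g (slice i a) = pmf (m i) a})"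
      using weights_le_1[OF g] by (auto simp: weights_def)
  qed (auto simp: weights_def PiE_iff split: if_splits)
  moreover have "compact ?box" by (rule compact_PiE_UNIV) auto
  moreover have "closed {g. sum g (slice i a) = pmf (m i) a}" for i a
    by (intro closed_Collect_eq continuous_intros continuous_on_product_coordinates)
  ultimately show ?thesis by (metis (no_types, lifting) closed_INT compact_Int_closed)
qed

lemma ex_positive_weights: "\<exists>g\<in>weights. \<forall>X\<in>grid. 0 < g X"
proof (intro bexI ballI)
  let ?p = "Pi_pmf UNIV undefined m"
  let ?\<gamma> = "map_pmf vec_lambda ?p"
  show "pmf ?\<gamma> \<in> weights"
    by (rule pmf_coupling_in_weights)
       (simp add: pmf_couplings_def pmf.map_comp o_def Pi_pmf_component)
  fix X assume "X \<in> grid"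
  hence "vec_nth X \<in> set_pmf ?p" by (auto simp: set_Pi_pmf PiE_dflt_def grid_def)
  hence "X \<in> set_pmf ?\<gamma>" by (metis imageI pmf.set_map vec_nth_inverse)
  thus "0 < pmf ?\<gamma> X" by (rule pmf_positive)
qed

definition barrier :: "('a ^ 'i \<Rightarrow> real) \<Rightarrow> real \<Rightarrow> ('a ^ 'i \<Rightarrow> real) \<Rightarrow> real" where
  "barrier c \<epsilon> g = (\<Sum>X\<in>grid. c X * g X / \<epsilon> + ln (g X))"

definition barrier_maximizer :: "('a ^ 'i \<Rightarrow> real) \<Rightarrow> real \<Rightarrow> ('a ^ 'i \<Rightarrow> real) \<Rightarrow> bool" where
  "barrier_maximizer c \<epsilon> g \<longleftrightarrow> g \<in> weights \<and> (\<forall>X\<in>grid. 0 < g X) \<and>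
     (\<forall>h\<in>weights. (\<forall>X\<in>grid. 0 < h X) \<longrightarrow> barrier c \<epsilon> h \<le> barrier c \<epsilon> g)"

text \<open>The exponential of the barrier functional extends continuously to the whole polytope, where it
  vanishes off the positive weights.\<close>

lemma ex_barrier_maximizer: "\<exists>g. barrier_maximizer c \<epsilon> g"
proof -
  define K where "K = (\<lambda>g. \<Prod>X\<in>grid. g X * exp (c X * g X / \<epsilon>))"
  have exp_barrier: "exp (barrier c \<epsilon> g) = K g" if "\<forall>X\<in>grid. 0 < g X" for g
    unfolding K_def barrier_def exp_sum[OF finite_grid]
    using that by (intro prod.cong) (auto simp: exp_add)
  have "continuous_on weights K"
    unfolding K_def divide_inverse
    by (intro continuous_intros continuous_on_subset[OF continuous_on_product_coordinates subset_UNIV])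
  then obtain g where g: "g \<in> weights" and max: "\<And>h. h \<in> weights \<Longrightarrow> K h \<le> K g"
    using continuous_attains_sup[OF compact_weights] ex_positive_weights by blast
  obtain q where q: "q \<in> weights" "\<forall>X\<in>grid. 0 < q X" using ex_positive_weights by blast
  have "0 < exp (barrier c \<epsilon> q)" by simp
  hence "0 < K g" using exp_barrier[OF q(2)] max[OF q(1)] by linarith
  hence "g X \<noteq> 0" if "X \<in> grid" for X
    using that prod_zero[OF finite_grid, of "\<lambda>X. g X * exp (c X * g X / \<epsilon>)"] by (auto simp: K_def)
  hence pos: "\<forall>X\<in>grid. 0 < g X" using g by (auto simp: weights_def less_le)
  have "barrier c \<epsilon> h \<le> barrier c \<epsilon> g" if "h \<in> weights" "\<forall>X\<in>grid. 0 < h X" for h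
    using max[OF that(1)] by (simp flip: exp_barrier[OF that(2)] exp_barrier[OF pos])
  thus ?thesis using g pos by (auto simp: barrier_maximizer_def)
qed

lemma barrier_first_order_condition:
  assumes g: "barrier_maximizer c \<epsilon> g"
    and h_grid: "\<And>X. X \<notin> grid \<Longrightarrow> h X = 0" and h_slice: "\<And>i a. sum h (slice i a) = 0"
  shows "(\<Sum>X\<in>grid. (c X / \<epsilon> + 1 / g X) * h X) = 0"
proof -
  have weights: "g \<in> weights" and pos: "\<And>X. X \<in> grid \<Longrightarrow> 0 < g X"
    and max: "\<And>h. h \<in> weights \<Longrightarrow> \<forall>X\<in>grid. 0 < h X \<Longrightarrow> barrier c \<epsilon> h \<le> barrier c \<epsilon> g"
    using g by (auto simp: barrier_maximizer_def)
  let ?g = "\<lambda>t X. g X + t * h X"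
  have "((\<lambda>t. barrier c \<epsilon> (?g t)) has_real_derivative (\<Sum>X\<in>grid. (c X / \<epsilon> + 1 / g X) * h X)) (at 0)"
    unfolding barrier_def
  proof (rule DERIV_sum)
    fix X assume "X \<in> grid"
    thus "((\<lambda>t. c X * ?g t X / \<epsilon> + ln (?g t X)) has_real_derivative (c X / \<epsilon> + 1 / g X) * h X) (at 0)"
      using pos by (auto intro!: derivative_eq_intros simp: divide_inverse algebra_simps)
  qed
  moreover have "\<forall>\<^sub>F t in nhds 0. \<forall>X\<in>grid. 0 < ?g t X"
  proof (rule eventually_ball_finite[OF finite_grid], rule ballI)
    fix X assume "X \<in> grid"
    have "((\<lambda>t. ?g t X) \<longlongrightarrow> g X + 0 * h X) (nhds 0)"
      by (intro tendsto_intros) (simp add: filterlim_def)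
    thus "\<forall>\<^sub>F t in nhds 0. 0 < ?g t X"
      by (rule order_tendstoD) (use pos[OF \<open>X \<in> grid\<close>] in simp)
  qed
  then obtain \<delta> where "\<delta> > 0" and \<delta>: "\<And>t. \<bar>t\<bar> < \<delta> \<Longrightarrow> \<forall>X\<in>grid. 0 < ?g t X"
    by (auto simp: eventually_nhds_metric dist_real_def)
  moreover have "barrier c \<epsilon> (?g t) \<le> barrier c \<epsilon> (?g 0)" if "\<bar>0 - t\<bar> < \<delta>" for t
  proof -
    have t_pos: "\<forall>X\<in>grid. 0 < ?g t X" using \<delta> that by simp
    hence "0 \<le> ?g t X" for X
      using weights h_grid[of X] by (cases "X \<in> grid") (auto simp: weights_def less_imp_le)
    moreover have "sum (?g t) (slice i a) = pmf (m i) a" if "a \<in> set_pmf (m i)" for i a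
      using weights that by (simp add: weights_def sum.distrib h_slice flip: sum_distrib_left)
    ultimately have "?g t \<in> weights" using weights h_grid by (simp add: weights_def)
    thus ?thesis using max[of "?g t"] t_pos by simp
  qed
  ultimately show ?thesis using DERIV_local_max by blast
qed

text \<open>Moving equal masses from \<open>X\<close> and \<open>Y\<close> to the two points with exchanged coordinate \<open>i\<close> does not
  change the marginals.\<close>

lemma barrier_maximizer_swap:
  assumes g: "barrier_maximizer c \<epsilon> g"
    and X: "X \<in> grid" and Y: "Y \<in> grid"
  defines "G \<equiv> \<lambda>X. c X / \<epsilon> + 1 / g X"
  shows "G X + G Y = G (vec_upd X i (Y $ i)) + G (vec_upd Y i (X $ i))"
proof -
  define X' Y' where "X' = vec_upd X i (Y $ i)" and "Y' = vec_upd Y i (X $ i)"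
  have X': "X' \<in> grid" "Y' \<in> grid" using X Y by (auto simp: X'_def Y'_def grid_def)
  define h :: "'a ^ 'i \<Rightarrow> real" where
    "h = (\<lambda>Z. of_bool (Z = X) + of_bool (Z = Y) - of_bool (Z = X') - of_bool (Z = Y'))"
  have "(\<Sum>Z\<in>A. F Z * of_bool (Z = W)) = F W * of_bool (W \<in> A)" if "finite A"
    for A W and F :: "'a ^ 'i \<Rightarrow> real"
    using that by (simp add: of_bool_def if_distrib cong: if_cong)
  hence pairing: "(\<Sum>Z\<in>A. F Z * h Z) = F X * of_bool (X \<in> A) + F Y * of_bool (Y \<in> A)
      - F X' * of_bool (X' \<in> A) - F Y' * of_bool (Y' \<in> A)" if "finite A" for A F
    using that by (simp add: h_def distrib_left right_diff_distrib sum.distrib sum_subtractf)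
  have "(\<Sum>Z\<in>grid. G Z * h Z) = 0"
    unfolding G_def
  proof (rule barrier_first_order_condition[OF g])
    show "h Z = 0" if "Z \<notin> grid" for Z using that X Y X' by (auto simp: h_def)
    show "sum h (slice j a) = 0" for j a
      using pairing[OF finite_slice, of "\<lambda>_. 1" j a] X Y X'
      by (cases "j = i") (auto simp: slice_def X'_def Y'_def)
  qed
  thus ?thesis using X Y X' by (simp add: pairing[OF finite_grid] flip: X'_def Y'_def)
qed

lemma ex_almost_tight_real_potentials:
  assumes e_pos: "e > 0"
  shows "\<exists>\<gamma>\<in>pmf_couplings m. \<exists>\<phi>. (\<forall>X\<in>grid. c X \<le> (\<Sum>i\<in>UNIV. \<phi> i (X $ i))) \<and>
     measure_pmf.prob \<gamma> {X. c X + e < (\<Sum>i\<in>UNIV. \<phi> i (X $ i))} \<le> e"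
proof -
  define \<epsilon> where "\<epsilon> = e * e / (1 + card grid)"
  have \<epsilon>: "\<epsilon> > 0" using e_pos by (simp add: \<epsilon>_def)
  obtain g where g: "barrier_maximizer c \<epsilon> g" using ex_barrier_maximizer by blast
  hence pos: "0 < g X" if "X \<in> grid" for X using that by (auto simp: barrier_maximizer_def)
  obtain \<gamma> where \<gamma>: "\<gamma> \<in> pmf_couplings m" and pmf_\<gamma>: "pmf \<gamma> = g"
    using ex_pmf_coupling_of_weights[of g] g by (auto simp: barrier_maximizer_def)
  obtain \<psi> where \<psi>: "\<And>X. X \<in> grid \<Longrightarrow> c X / \<epsilon> + 1 / g X = (\<Sum>i\<in>UNIV. \<psi> i (X $ i))"
    using swap_invariant_imp_separable[of "\<lambda>i. set_pmf (m i)" "\<lambda>X. c X / \<epsilon> + 1 / g X"]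
      barrier_maximizer_swap[OF g] unfolding grid_def by blast
  define \<phi> where "\<phi> = (\<lambda>i x. \<epsilon> * \<psi> i x)"
  have \<phi>: "(\<Sum>i\<in>UNIV. \<phi> i (X $ i)) = c X + \<epsilon> / g X" if "X \<in> grid" for X
    using \<epsilon> by (simp add: \<phi>_def \<psi>[OF that, symmetric] distrib_left flip: sum_distrib_left)
  let ?bad = "{X\<in>grid. c X + e < (\<Sum>i\<in>UNIV. \<phi> i (X $ i))}"
  have "measure \<gamma> {X. c X + e < (\<Sum>i\<in>UNIV. \<phi> i (X $ i))} = measure \<gamma> ?bad"
    by (rule measure_pmf.finite_measure_eq_AE)
       (use set_pmf_coupling[OF \<gamma>] in \<open>auto simp: AE_measure_pmf_iff grid_def\<close>)
  also have "\<dots> = sum g ?bad" by (simp add: measure_measure_pmf_finite finite_grid pmf_\<gamma>)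
  also have "\<dots> \<le> (\<Sum>X\<in>?bad. \<epsilon> / e)"
    by (rule sum_mono) (use pos e_pos in \<open>auto simp: \<phi> field_simps\<close>)
  also have "\<dots> \<le> (\<Sum>X\<in>grid. \<epsilon> / e)" using e_pos \<epsilon> finite_grid by (intro sum_mono2) auto
  also have "\<dots> = e * (card grid / (1 + card grid))" using e_pos by (simp add: \<epsilon>_def)
  also have "\<dots> \<le> e" using e_pos by (intro mult_left_le) auto
  finally have "measure \<gamma> {X. c X + e < (\<Sum>i\<in>UNIV. \<phi> i (X $ i))} \<le> e" .
  moreover have "\<forall>X\<in>grid. c X \<le> (\<Sum>i\<in>UNIV. \<phi> i (X $ i))"
    using pos \<epsilon> by (simp add: \<phi> less_imp_le)
  ultimately show ?thesis using \<gamma> by blast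
qed

end

lemma admissible_extend_by_PInfty:
  fixes c :: "'a::t1_space ^ 'i::finite \<Rightarrow> real"
  assumes finite: "\<And>i. finite (S i)"
    and dominated: "\<And>X. X \<in> Pi_vec S \<Longrightarrow> c X \<le> (\<Sum>i\<in>UNIV. \<phi> i (X $ i))"
  shows "(\<lambda>i x. if x \<in> S i then ereal (\<phi> i x) else \<infinity>) \<in> admissible c"
proof (rule admissibleI)
  show "lower_semicontinuous (\<lambda>x. if x \<in> S i then ereal (\<phi> i x) else \<infinity>)" for i
    unfolding lower_semicontinuous_def
  proof
    fix t :: ereal
    show "open {x. t < (if x \<in> S i then ereal (\<phi> i x) else \<infinity>)}"
    proof (cases "t = \<infinity>")
      case False
      hence
        "{x. t < (if x \<in> S i then ereal (\<phi> i x) else \<infinity>)} = - {x \<in> S i. ereal (\<phi> i x) \<le> t}"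
        by auto
      moreover have "closed {x \<in> S i. ereal (\<phi> i x) \<le> t}"
        using finite by (intro finite_imp_closed) simp
      ultimately show ?thesis by (simp only: open_Compl)
    qed simp
  qed
  show "ereal (c X) \<le> (\<Sum>i\<in>UNIV. if X $ i \<in> S i then ereal (\<phi> i (X $ i)) else \<infinity>)" for X
  proof (cases "X \<in> Pi_vec S")
    case False
    hence "(\<Sum>i\<in>UNIV. if X $ i \<in> S i then ereal (\<phi> i (X $ i)) else \<infinity>) = \<infinity>"
      by (auto simp: sum_Pinfty)
    thus ?thesis by simp
  qed (use dominated in simp)
qed auto

lemma ex_almost_tight_potentials:
  fixes m :: "'i::finite \<Rightarrow> 'a::t1_space pmf" and c :: "'a ^ 'i \<Rightarrow> real"
  assumes finite: "\<And>i. finite (set_pmf (m i))" and e_pos: "e > 0"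
  shows "\<exists>\<gamma>\<in>pmf_couplings m. \<exists>\<phi>\<in>admissible c.
     measure_pmf.prob \<gamma> {X. ereal (c X + e) < (\<Sum>i\<in>UNIV. \<phi> i (X $ i))} \<le> e"
proof -
  interpret finite_marginals m by unfold_locales (rule finite)
  obtain \<gamma> \<psi> where \<gamma>: "\<gamma> \<in> pmf_couplings m"
    and dominated: "\<forall>X\<in>grid. c X \<le> (\<Sum>i\<in>UNIV. \<psi> i (X $ i))"
    and slack: "measure_pmf.prob \<gamma> {X. c X + e < (\<Sum>i\<in>UNIV. \<psi> i (X $ i))} \<le> e"
    using ex_almost_tight_real_potentials[OF e_pos] by blast
  define \<phi> where "\<phi> = (\<lambda>i x. if x \<in> set_pmf (m i) then ereal (\<psi> i x) else \<infinity>)"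
  have \<phi>: "\<phi> \<in> admissible c"
    unfolding \<phi>_def
    by (rule admissible_extend_by_PInfty) (use finite dominated in \<open>auto simp: grid_def\<close>)
  have "(\<Sum>i\<in>UNIV. \<phi> i (X $ i)) = ereal (\<Sum>i\<in>UNIV. \<psi> i (X $ i))" if "X \<in> set_pmf \<gamma>" for X
    using that set_pmf_coupling[OF \<gamma>] by (auto simp: \<phi>_def)
  hence "measure_pmf.prob \<gamma> {X. ereal (c X + e) < (\<Sum>i\<in>UNIV. \<phi> i (X $ i))} =
      measure_pmf.prob \<gamma> {X. c X + e < (\<Sum>i\<in>UNIV. \<psi> i (X $ i))}"
    by (intro measure_pmf.finite_measure_eq_AE) (auto simp: AE_measure_pmf_iff)
  thus ?thesis using \<gamma> \<phi> slack by (intro bexI[of _ \<gamma>] bexI[of _ \<phi>]) simp_all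
qed

section \<open>Discretisation of second countable spaces\<close>

definition basic_open :: "nat \<Rightarrow> 'a::second_countable_topology set" where
  "basic_open = from_nat_into (SOME B. countable B \<and> topological_basis B)"

lemma
  shows open_basic_open [simp]: "open (basic_open k :: 'a::second_countable_topology set)"
    and ex_basic_open: "open (V :: 'a set) \<Longrightarrow> x \<in> V \<Longrightarrow> \<exists>k. x \<in> basic_open k \<and> basic_open k \<subseteq> V"
proof -
  define B :: "'a set set" where "B = (SOME B. countable B \<and> topological_basis B)"
  have "countable B \<and> topological_basis B"
    unfolding B_def using ex_countable_basis by (rule someI_ex)
  hence B: "countable B" "topological_basis B" by auto
  have basic_open: "basic_open = from_nat_into B" by (simp add: basic_open_def B_def)
  have "B \<noteq> {}" using topological_basisE[OF B(2) open_UNIV UNIV_I] by auto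
  thus "open (basic_open k :: 'a set)"
    unfolding basic_open by (intro topological_basis_open[OF B(2)] from_nat_into)
  assume "open V" "x \<in> V"
  then obtain W where "W \<in> B" "x \<in> W" "W \<subseteq> V" by (rule topological_basisE[OF B(2)])
  thus "\<exists>k. x \<in> basic_open k \<and> basic_open k \<subseteq> V"
    unfolding basic_open using from_nat_into_surj[OF B(1)] by metis
qed

lemma sets_basic_open [measurable]: "basic_open k \<in> sets borel"
  by (rule borel_open) simp

definition discretize :: "nat \<Rightarrow> 'a::second_countable_topology \<Rightarrow> 'a" where
  "discretize n x = (SOME y. \<forall>k<n. y \<in> basic_open k \<longleftrightarrow> x \<in> basic_open k)"

lemma discretize_in_basic_open_iff:
  assumes "k < n"
  shows "discretize n x \<in> basic_open k \<longleftrightarrow> x \<in> basic_open k"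
proof -
  have "\<forall>k<n. discretize n x \<in> basic_open k \<longleftrightarrow> x \<in> basic_open k"
    unfolding discretize_def by (rule someI[of _ x]) simp
  thus ?thesis using assms by blast
qed

lemma discretize_eq_iff:
  "discretize n x = discretize n y \<longleftrightarrow> (\<forall>k<n. x \<in> basic_open k \<longleftrightarrow> y \<in> basic_open k)"
proof
  show "discretize n x = discretize n y \<Longrightarrow> \<forall>k<n. x \<in> basic_open k \<longleftrightarrow> y \<in> basic_open k"
    by (metis discretize_in_basic_open_iff)
qed (auto simp: discretize_def intro!: arg_cong[where f = Eps])

lemma discretize_discretize: "N \<le> n \<Longrightarrow> discretize N (discretize n x) = discretize N x"
  by (auto simp: discretize_eq_iff discretize_in_basic_open_iff)

lemma finite_range_discretize: "finite (range (discretize n :: 'a::second_countable_topology \<Rightarrow> 'a))"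
proof (rule finite_surj)
  let ?point = "\<lambda>A. SOME y :: 'a. \<forall>k<n. y \<in> basic_open k \<longleftrightarrow> k \<in> A"
  show "range (discretize n :: 'a \<Rightarrow> 'a) \<subseteq> ?point ` Pow {..<n}"
  proof (rule image_subsetI)
    fix x :: 'a
    show "discretize n x \<in> ?point ` Pow {..<n}"
      by (rule image_eqI[of _ _ "{k. k < n \<and> x \<in> basic_open k}"])
         (auto simp: discretize_def intro!: arg_cong[where f = Eps])
  qed
qed simp

lemma measurable_discretize [measurable]:
  "(discretize n :: 'a::second_countable_topology \<Rightarrow> 'a) \<in> measurable borel (count_space UNIV)"
proof (rule measurableI)
  fix A :: "'a set"
  have "discretize n -` A = (\<Union>y\<in>A \<inter> range (discretize n). {x. discretize n x = discretize n y})"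
    by (auto simp: discretize_discretize)
  moreover have "{x\<in>space borel. \<forall>k<n. x \<in> basic_open k \<longleftrightarrow> y \<in> basic_open k} \<in> sets borel"
    for y :: 'a
    by measurable
  ultimately show "discretize n -` A \<inter> space borel \<in> sets borel"
    by (simp add: discretize_eq_iff sets.finite_UN finite_range_discretize)
qed simp

lemma borel_measurable_discretize [measurable]: "discretize n \<in> borel_measurable borel"
  by (rule measurable_compose[OF measurable_discretize]) simp

lemma discretize_eq_imp_in_open:
  assumes "open V" "x \<in> V"
  shows "\<exists>N. \<forall>n\<ge>N. \<forall>y. discretize n y = discretize n x \<longrightarrow> y \<in> V"
proof -
  obtain k where k: "x \<in> basic_open k" "basic_open k \<subseteq> V" using ex_basic_open[OF assms] by blast
  thus ?thesis by (intro exI[of _ "Suc k"]) (auto simp: discretize_eq_iff)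
qed

lemma open_vec_contains_box:
  fixes X :: "'a::topological_space ^ 'i::finite"
  assumes "open V" "X \<in> V"
  shows "\<exists>W. (\<forall>i. open (W i)) \<and> X \<in> Pi_vec W \<and> Pi_vec W \<subseteq> V"
proof -
  obtain W where "\<forall>i. open (W i) \<and> X $ i \<in> W i" "\<forall>Y. (\<forall>i. Y $ i \<in> W i) \<longrightarrow> Y \<in> V"
    using assms unfolding open_vec_def by blast
  thus ?thesis by (intro exI[of _ W]) auto
qed

lemma discretize_vec_eq_imp_in_open:
  fixes X :: "'a::second_countable_topology ^ 'i::finite"
  assumes "open V" "X \<in> V"
  shows "\<exists>n. \<forall>Y. (\<forall>i. discretize n (Y $ i) = discretize n (X $ i)) \<longrightarrow> Y \<in> V"
proof -
  obtain W where W: "\<And>i. open (W i)" "X \<in> Pi_vec W" "Pi_vec W \<subseteq> V"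
    using open_vec_contains_box[OF assms] by blast
  have "\<forall>i. \<exists>N. \<forall>n\<ge>N. \<forall>y. discretize n y = discretize n (X $ i) \<longrightarrow> y \<in> W i"
    using W(1,2) by (intro allI discretize_eq_imp_in_open) auto
  then obtain N where N: "\<And>i n y. N i \<le> n \<Longrightarrow> discretize n y = discretize n (X $ i) \<Longrightarrow> y \<in> W i"
    by metis
  have "N i \<le> Max (range N)" for i by (rule Max_ge) auto
  hence "Y \<in> Pi_vec W"
    if "\<forall>i. discretize (Max (range N)) (Y $ i) = discretize (Max (range N)) (X $ i)" for Y
    using that by (auto intro: N[of _ "Max (range N)"])
  thus ?thesis using W(3) by blast
qed

lemma discretize_tendsto: "(\<lambda>n. discretize n x) \<longlonglongrightarrow> x"
proof (rule topological_tendstoI)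
  fix V :: "'a set" assume "open V" "x \<in> V"
  then obtain N where N: "\<And>n y. N \<le> n \<Longrightarrow> discretize n y = discretize n x \<Longrightarrow> y \<in> V"
    using discretize_eq_imp_in_open by metis
  have "discretize n x \<in> V" if "N \<le> n" for n
    using that by (rule N) (rule discretize_discretize[OF order_refl])
  thus "\<forall>\<^sub>F n in sequentially. discretize n x \<in> V" by (rule eventually_sequentiallyI)
qed

section \<open>Compactness for laws of finitely valued processes\<close>

lemma convergent_subsequence_countable:
  fixes f :: "nat \<Rightarrow> 'k \<Rightarrow> 'b::{complete_linorder,linorder_topology}"
  assumes "countable K"
  shows "\<exists>r l. strict_mono r \<and> (\<forall>k\<in>K. (\<lambda>n. f (r n) k) \<longlonglongrightarrow> l k)"
proof -
  define e where "e = from_nat_into K"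
  interpret subseqs "\<lambda>n s. \<exists>l. (\<lambda>i. f (s i) (e n)) \<longlonglongrightarrow> l"
  proof
    fix n and s :: "nat \<Rightarrow> nat"
    show "\<exists>r. strict_mono r \<and> (\<exists>l. (\<lambda>i. f ((s \<circ> r) i) (e n)) \<longlonglongrightarrow> l)"
      using compact_complete_linorder[of "\<lambda>i. f (s i) (e n)"] by (auto simp: o_def)
  qed
  have "\<exists>l. (\<lambda>i. f (diagseq i) k) \<longlonglongrightarrow> l" if "k \<in> K" for k
  proof -
    obtain n where n: "e n = k" using from_nat_into_surj[OF assms \<open>k \<in> K\<close>] by (auto simp: e_def)
    have "\<exists>l. (\<lambda>i. f ((diagseq \<circ> (+) (Suc n)) i) (e n)) \<longlonglongrightarrow> l"
    proof (rule diagseq_holds)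
      fix r s :: "nat \<Rightarrow> nat" and n
      assume "strict_mono r" "\<exists>l. (\<lambda>i. f (s i) (e n)) \<longlonglongrightarrow> l"
      thus "\<exists>l. (\<lambda>i. f ((s \<circ> r) i) (e n)) \<longlonglongrightarrow> l"
        using LIMSEQ_subseq_LIMSEQ[of "\<lambda>i. f (s i) (e n)" _ r] by (auto simp: o_def)
    qed
    then obtain l where "(\<lambda>i. f (diagseq (i + Suc n)) k) \<longlonglongrightarrow> l" by (auto simp: add.commute n)
    thus ?thesis by (blast intro: LIMSEQ_offset)
  qed
  hence "\<exists>l. \<forall>k\<in>K. (\<lambda>i. f (diagseq i) k) \<longlonglongrightarrow> l k" by (intro bchoice ballI)
  thus ?thesis using subseq_diagseq by blast
qed

lemma ex_pmf_limit:
  fixes p :: "nat \<Rightarrow> 'a pmf"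
  assumes S: "finite S"
    and supp: "\<And>n. set_pmf (p n) \<subseteq> S" and lim: "\<And>x. x \<in> S \<Longrightarrow> (\<lambda>n. pmf (p n) x) \<longlonglongrightarrow> w x"
  shows "\<exists>q. \<forall>A. (\<lambda>n. measure_pmf.prob (p n) A) \<longlonglongrightarrow> measure_pmf.prob q A"
proof -
  have prob_eq: "measure_pmf.prob q A = sum (pmf q) (A \<inter> S)" if "set_pmf q \<subseteq> S" for q A
    using measure_Int_set_pmf[of q A] measure_Int_set_pmf[of q "A \<inter> S"] S that
    by (simp add: Int_assoc Int_absorb1 flip: measure_measure_pmf_finite)
  define w' where "w' = (\<lambda>x. if x \<in> S then w x else 0)"
  have "\<exists>q. pmf q = w'"
  proof (rule ex_pmf_of_weights[OF S])
    show "0 \<le> w' x" for x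
      using LIMSEQ_le_const[OF lim] by (cases "x \<in> S") (auto simp: w'_def)
    have "(\<lambda>n. \<Sum>x\<in>S. pmf (p n) x) \<longlonglongrightarrow> (\<Sum>x\<in>S. w' x)"
      using lim by (intro tendsto_sum) (simp add: w'_def)
    thus "sum w' S = 1" by (simp add: sum_pmf_eq_1[OF S supp] LIMSEQ_const_iff)
  qed (simp add: w'_def)
  then obtain q where q: "pmf q = w'" by blast
  have "set_pmf q \<subseteq> S" by (auto simp: set_pmf_eq q w'_def)
  hence "(\<lambda>n. measure_pmf.prob (p n) A) \<longlonglongrightarrow> measure_pmf.prob q A" for A
    by (auto simp: prob_eq supp q w'_def intro!: tendsto_sum lim)
  thus ?thesis by blast
qed

lemma ex_pmf_limit_family:
  fixes p :: "nat \<Rightarrow> 'j \<Rightarrow> 'a pmf"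
  assumes "countable J" and finite: "\<And>j. j \<in> J \<Longrightarrow> finite (S j)"
    and supp: "\<And>n j. j \<in> J \<Longrightarrow> set_pmf (p n j) \<subseteq> S j"
  shows "\<exists>r q. strict_mono r \<and>
     (\<forall>j\<in>J. \<forall>A. (\<lambda>n. measure_pmf.prob (p (r n) j) A) \<longlonglongrightarrow> measure_pmf.prob (q j) A)"
proof -
  have "countable (Sigma J S)" using assms by (intro countable_SIGMA) (auto intro: countable_finite)
  from convergent_subsequence_countable[OF this, of "\<lambda>n (j, x). ereal (pmf (p n j) x)"]
  obtain r l where r: "strict_mono r"
    and l: "\<And>j x. j \<in> J \<Longrightarrow> x \<in> S j \<Longrightarrow> (\<lambda>n. ereal (pmf (p (r n) j) x)) \<longlonglongrightarrow> l (j, x)"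
    by fastforce
  have "(\<lambda>n. pmf (p (r n) j) x) \<longlonglongrightarrow> real_of_ereal (l (j, x))" if "j \<in> J" "x \<in> S j" for j x
  proof -
    have "0 \<le> l (j, x)" by (rule LIMSEQ_le_const[OF l[OF that]]) auto
    moreover have "l (j, x) \<le> 1" by (rule LIMSEQ_le_const2[OF l[OF that]]) (auto simp: pmf_le_1)
    ultimately have real: "ereal (real_of_ereal (l (j, x))) = l (j, x)" by (cases "l (j, x)") auto
    show ?thesis by (subst lim_ereal[symmetric]) (simp only: real l[OF that])
  qed
  hence "\<exists>q. \<forall>A. (\<lambda>n. measure_pmf.prob (p (r n) j) A) \<longlonglongrightarrow> measure_pmf.prob q A" if "j \<in> J" for j
    using that finite supp by (intro ex_pmf_limit[of "S j"])
  hence "\<exists>q. \<forall>j\<in>J. \<forall>A. (\<lambda>n. measure_pmf.prob (p (r n) j) A) \<longlonglongrightarrow> measure_pmf.prob (q j) A"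
    by (intro bchoice ballI)
  thus ?thesis using r by blast
qed

lemma polish_projective_of_consistent_pmfs:
  fixes q :: "'k set \<Rightarrow> ('k \<Rightarrow> 'a::polish_space) pmf"
  assumes consistent: "\<And>J H. J \<subseteq> H \<Longrightarrow> finite H \<Longrightarrow> map_pmf (\<lambda>\<omega>. restrict \<omega> J) (q H) = q J"
  shows "polish_projective UNIV (\<lambda>J. distr (measure_pmf (q J)) (PiM J (\<lambda>_. borel)) (\<lambda>\<omega>. restrict \<omega> J))"
    (is "polish_projective UNIV ?P")
proof (intro polish_projective.intro projective_family.intro)
  have restrict_meas:
    "(\<lambda>\<omega>. restrict \<omega> J) \<in> measurable (measure_pmf p) (PiM J (\<lambda>_. borel :: 'a measure))"
    for J :: "'k set" and p :: "('k \<Rightarrow> 'a) pmf"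
    by (auto simp: space_PiM)
  show "prob_space (?P J)" for J by (rule measure_pmf.prob_space_distr[OF restrict_meas])
  fix J H :: "'k set" assume "J \<subseteq> H" "finite H"
  have "?P J = distr (distr (measure_pmf (q H)) (count_space UNIV) (\<lambda>\<omega>. restrict \<omega> J))
      (PiM J (\<lambda>_. borel)) (\<lambda>\<omega>. restrict \<omega> J)"
    by (simp add: consistent[OF \<open>J \<subseteq> H\<close> \<open>finite H\<close>, symmetric] map_pmf_rep_eq)
  also have "\<dots> = distr (measure_pmf (q H)) (PiM J (\<lambda>_. borel)) (\<lambda>\<omega>. restrict (restrict \<omega> H) J)"
    using \<open>J \<subseteq> H\<close> by (subst distr_distr) (auto simp: space_PiM o_def Int_absorb1)
  also have "\<dots> = distr (?P H) (PiM J (\<lambda>_. borel)) (\<lambda>\<omega>. restrict \<omega> J)"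
    using \<open>J \<subseteq> H\<close>
    by (subst distr_distr[OF measurable_restrict_subset restrict_meas]) (auto simp: o_def)
  finally show "?P J = distr (?P H) (PiM J (\<lambda>_. borel)) (\<lambda>\<omega>. restrict \<omega> J)" .
qed

lemma ex_process_with_finite_dimensional_laws:
  fixes q :: "'k set \<Rightarrow> ('k \<Rightarrow> 'a::polish_space) pmf"
  assumes consistent: "\<And>J H. J \<subseteq> H \<Longrightarrow> finite H \<Longrightarrow> map_pmf (\<lambda>\<omega>. restrict \<omega> J) (q H) = q J"
  shows "\<exists>M. prob_space M \<and> sets M = sets (PiM UNIV (\<lambda>_. borel)) \<and>
     (\<forall>J A. finite J \<longrightarrow> (\<forall>k\<in>J. A k \<in> sets borel) \<longrightarrow>
       measure M (Pi J A) = measure_pmf.prob (q J) (Pi J A))"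
proof -
  let ?P = "\<lambda>J. distr (measure_pmf (q J)) (PiM J (\<lambda>_. borel :: 'a measure)) (\<lambda>\<omega>. restrict \<omega> J)"
  interpret polish_projective UNIV ?P by (rule polish_projective_of_consistent_pmfs[OF consistent])
  have "measure lim (Pi J A) = measure_pmf.prob (q J) (Pi J A)"
    if J: "finite J" and A: "\<forall>k\<in>J. A k \<in> sets borel" for J A
  proof -
    have box: "PiE J A \<in> sets (PiM J (\<lambda>_. borel))" using A by (intro sets_PiM_I_finite[OF J]) auto
    have "Pi J A = emb UNIV J (PiE J A)" by (auto simp: prod_emb_def space_PiM)
    also have "measure lim \<dots> = measure (?P J) (PiE J A)"
      using J box by (intro measure_lim_emb) auto
    also have "\<dots> = measure_pmf.prob (q J) (Pi J A)"
      using box by (subst measure_distr) (auto simp: space_PiM vimage_def PiE_iff Pi_def Ball_def)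
    finally show ?thesis .
  qed
  thus ?thesis using P.prob_space_axioms sets_lim by blast
qed

definition finite_dimensional_limit ::
    "(nat \<Rightarrow> ('k \<Rightarrow> 'a::topological_space) pmf) \<Rightarrow> ('k \<Rightarrow> 'a) measure \<Rightarrow> bool" where
  "finite_dimensional_limit p M \<longleftrightarrow> prob_space M \<and> sets M = sets (PiM UNIV (\<lambda>_. borel)) \<and>
     (\<forall>J A. finite J \<longrightarrow> (\<forall>k\<in>J. A k \<in> sets borel) \<longrightarrow>
        (\<lambda>n. measure_pmf.prob (p n) (Pi J A)) \<longlonglongrightarrow> measure M (Pi J A))"

lemma ex_limit_finite_dimensional_laws:
  fixes p :: "nat \<Rightarrow> ('k::countable \<Rightarrow> 'a) pmf"
  assumes finite: "\<And>k. finite (S k)" and supp: "\<And>n. set_pmf (p n) \<subseteq> Pi UNIV S"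
  shows "\<exists>r q. strict_mono r \<and> (\<forall>J A. finite J \<longrightarrow>
     (\<lambda>n. measure_pmf.prob (map_pmf (\<lambda>\<omega>. restrict \<omega> J) (p (r n))) A) \<longlonglongrightarrow> measure_pmf.prob (q J) A)"
proof -
  let ?p = "\<lambda>n J. map_pmf (\<lambda>\<omega>. restrict \<omega> J) (p n)"
  have "\<exists>r q. strict_mono r \<and> (\<forall>J\<in>Collect finite. \<forall>A.
      (\<lambda>n. measure_pmf.prob (?p (r n) J) A) \<longlonglongrightarrow> measure_pmf.prob (q J) A)"
  proof (rule ex_pmf_limit_family)
    show "countable {J :: 'k set. finite J}" by (rule countable_Collect_finite)
    show "finite (PiE J S)" if "J \<in> Collect finite" for J
      using that finite by (intro finite_PiE) auto
    show "set_pmf (?p n J) \<subseteq> PiE J S" for n J using supp[of n] by (fastforce simp: Pi_iff)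
  qed
  thus ?thesis by simp
qed

lemma ex_finite_dimensional_limit:
  fixes p :: "nat \<Rightarrow> ('k::countable \<Rightarrow> 'a::polish_space) pmf"
  assumes finite: "\<And>k. finite (S k)" and supp: "\<And>n. set_pmf (p n) \<subseteq> Pi UNIV S"
  shows "\<exists>r M. strict_mono r \<and> finite_dimensional_limit (\<lambda>n. p (r n)) M"
proof -
  let ?p = "\<lambda>n J. map_pmf (\<lambda>\<omega>. restrict \<omega> J) (p n)"
  obtain r q where r: "strict_mono r" and lim [rule_format]: "\<forall>J A. finite J \<longrightarrow>
      (\<lambda>n. measure_pmf.prob (?p (r n) J) A) \<longlonglongrightarrow> measure_pmf.prob (q J) A"
    using ex_limit_finite_dimensional_laws[of S p, OF finite supp] by (elim exE conjE)
  have consistent: "map_pmf (\<lambda>\<omega>. restrict \<omega> J) (q H) = q J" if "J \<subseteq> H" "finite H" for J H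
  proof (rule pmf_eqI)
    fix \<omega> :: "'k \<Rightarrow> 'a"
    let ?E = "(\<lambda>\<omega>. restrict \<omega> J) -` {\<omega>}"
    have "measure_pmf.prob (?p n H) ?E = measure_pmf.prob (?p n J) {\<omega>}" for n
      using \<open>J \<subseteq> H\<close> by (simp add: vimage_def Int_absorb1)
    hence "(\<lambda>n. measure_pmf.prob (?p (r n) J) {\<omega>}) \<longlonglongrightarrow> measure_pmf.prob (q H) ?E"
      using lim[OF \<open>finite H\<close>, of ?E] by (simp only:)
    hence "measure_pmf.prob (q J) {\<omega>} = measure_pmf.prob (q H) ?E"
      by (rule LIMSEQ_unique[OF lim[OF finite_subset[OF that]]])
    thus "pmf (map_pmf (\<lambda>\<omega>. restrict \<omega> J) (q H)) \<omega> = pmf (q J) \<omega>"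
      by (simp add: pmf_map measure_pmf_single)
  qed
  have "\<exists>M. prob_space M \<and> sets M = sets (PiM UNIV (\<lambda>_. borel)) \<and>
     (\<forall>J A. finite J \<longrightarrow> (\<forall>k\<in>J. A k \<in> sets borel) \<longrightarrow>
       measure M (Pi J A) = measure_pmf.prob (q J) (Pi J A))"
    by (rule ex_process_with_finite_dimensional_laws) (rule consistent)
  then obtain M where "prob_space M" "sets M = sets (PiM UNIV (\<lambda>_. borel :: 'a measure))"
    and law: "\<forall>J A. finite J \<longrightarrow> (\<forall>k\<in>J. A k \<in> sets borel) \<longrightarrow>
        measure M (Pi J A) = measure_pmf.prob (q J) (Pi J A)" by (elim exE conjE)
  moreover have "measure_pmf.prob (?p n J) (Pi J A) = measure_pmf.prob (p n) (Pi J A)" for n J A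
    by (simp add: vimage_def Pi_def)
  hence "(\<lambda>n. measure_pmf.prob (p (r n)) (Pi J A)) \<longlonglongrightarrow> measure M (Pi J A)"
    if "finite J" "\<forall>k\<in>J. A k \<in> sets borel" for J A
    using lim[OF \<open>finite J\<close>, of "Pi J A"] law that by simp
  ultimately show ?thesis
    using r by (intro exI[of _ r] exI[of _ M]) (simp add: finite_dimensional_limit_def)
qed

section \<open>Limits of couplings of discretised marginals\<close>

lemma (in prob_space) measure_pmf_Abs_pmf_distr:
  assumes meas: "f \<in> measurable M (count_space UNIV)" and "countable (range f)"
  shows "measure_pmf (Abs_pmf (distr M (count_space UNIV) f)) = distr M (count_space UNIV) f"
proof -
  let ?D = "distr M (count_space UNIV) f"
  interpret D: prob_space ?D by (rule prob_space_distr[OF meas])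
  have "AE y in ?D. y \<in> range f" by (simp add: AE_distr_iff[OF meas])
  hence "AE y in ?D. measure ?D {y} \<noteq> 0"
    using assms(2) by (subst D.AE_support_countable) auto
  thus ?thesis using D.prob_space_axioms by (intro Abs_pmf_inverse) simp
qed

definition discretized_pmf :: "nat \<Rightarrow> 'a::second_countable_topology measure \<Rightarrow> 'a pmf" where
  "discretized_pmf n \<mu> = Abs_pmf (distr \<mu> (count_space UNIV) (discretize n))"

lemma
  assumes "prob_space \<mu>" and sets: "sets \<mu> = sets borel"
  shows measure_pmf_discretized_pmf:
    "measure_pmf (discretized_pmf n \<mu>) = distr \<mu> (count_space UNIV) (discretize n)"
    and finite_set_discretized_pmf: "finite (set_pmf (discretized_pmf n \<mu>))"
proof -
  interpret prob_space \<mu> by fact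
  have disc: "discretize n \<in> measurable \<mu> (count_space UNIV)"
    by (simp add: measurable_cong_sets[OF sets refl] measurable_discretize)
  show law: "measure_pmf (discretized_pmf n \<mu>) = distr \<mu> (count_space UNIV) (discretize n)"
    unfolding discretized_pmf_def
    by (rule measure_pmf_Abs_pmf_distr[OF disc]) (intro countable_finite finite_range_discretize)
  have "AE x in measure_pmf (discretized_pmf n \<mu>). x \<in> range (discretize n)"
    unfolding law by (simp add: AE_distr_iff[OF disc])
  hence "set_pmf (discretized_pmf n \<mu>) \<subseteq> range (discretize n)" by (auto simp: AE_measure_pmf_iff)
  thus "finite (set_pmf (discretized_pmf n \<mu>))"
    using finite_range_discretize by (rule finite_subset)
qed

lemma measurable_discretize_sequence [measurable]:
  "(\<lambda>x n. discretize n x) \<in> measurable borel (PiM UNIV (\<lambda>_. borel))"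
  by (rule measurable_PiM_single') auto

lemma borel_measurable_lim_sequence [measurable]:
  "lim \<in> borel_measurable
    (PiM UNIV (\<lambda>_ :: nat. borel :: 'a::{banach, second_countable_topology} measure))"
  by (rule borel_measurable_lim_metric[of "\<lambda>k f. f k"]) measurable

lemma
  fixes Y :: "'w \<Rightarrow> nat \<Rightarrow> 'a::{banach, second_countable_topology}"
  assumes Y [measurable]: "Y \<in> measurable M (PiM UNIV (\<lambda>_. borel))" and sets: "sets \<mu> = sets borel"
    and law:
      "distr M (PiM UNIV (\<lambda>_. borel)) Y = distr \<mu> (PiM UNIV (\<lambda>_. borel)) (\<lambda>x n. discretize n x)"
  shows distr_lim_discretizations: "distr M borel (\<lambda>\<omega>. lim (Y \<omega>)) = \<mu>"
    and AE_discretize_lim_discretizations: "AE \<omega> in M. \<forall>n. discretize n (lim (Y \<omega>)) = Y \<omega> n"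
proof -
  note sets[measurable_cong]
  have disc: "(\<lambda>x n. discretize n x) \<in> measurable \<mu> (PiM UNIV (\<lambda>_ :: nat. borel))" by measurable
  have lim: "lim (\<lambda>n. discretize n x) = x" for x :: 'a by (rule limI[OF discretize_tendsto])
  have "distr M borel (\<lambda>\<omega>. lim (Y \<omega>)) = distr (distr M (PiM UNIV (\<lambda>_. borel)) Y) borel lim"
    by (subst distr_distr) (auto simp: o_def)
  also have "\<dots> = distr \<mu> borel (\<lambda>x. x)"
    unfolding law by (subst distr_distr[OF _ disc]) (auto simp: o_def lim)
  finally show "distr M borel (\<lambda>\<omega>. lim (Y \<omega>)) = \<mu>" by (simp add: distr_id2 sets)
  have "{f \<in> space (PiM UNIV (\<lambda>_. borel)). discretize n (lim f) = (f n :: 'a)}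
    \<in> sets (PiM UNIV (\<lambda>_. borel))" for n
    by (rule measurable_equality_set) measurable
  hence [measurable]:
    "Measurable.pred (PiM UNIV (\<lambda>_. borel)) (\<lambda>f. discretize n (lim f) = (f n :: 'a))" for n
    by (simp add: pred_def)
  have "AE f in distr \<mu> (PiM UNIV (\<lambda>_. borel)) (\<lambda>x n. discretize n x). \<forall>n. discretize n (lim f) = f n"
    by (subst AE_distr_iff[OF disc]) (simp_all add: lim)
  thus "AE \<omega> in M. \<forall>n. discretize n (lim (Y \<omega>)) = Y \<omega> n"
    unfolding law[symmetric] by (rule AE_distrD[OF Y])
qed

lemma borel_measurable_vecI:
  fixes f :: "'b \<Rightarrow> 'a::euclidean_space ^ 'i::finite"
  assumes "\<And>i. (\<lambda>x. f x $ i) \<in> borel_measurable M"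
  shows "f \<in> borel_measurable M"
proof -
  have "(\<lambda>x. f x \<bullet> b) \<in> borel_measurable M" if b: "b \<in> Basis" for b
  proof -
    obtain i u where "b = axis i u" using b by (auto simp: Basis_vec_def)
    hence "(\<lambda>x. f x \<bullet> b) = (\<lambda>x. f x $ i \<bullet> u)" by (simp add: inner_axis)
    thus ?thesis using assms[of i] by (simp add: borel_measurable_inner)
  qed
  thus ?thesis by (subst borel_measurable_euclidean_space) auto
qed

definition cell :: "nat \<Rightarrow> ('i \<Rightarrow> 'a::second_countable_topology) \<Rightarrow> ('a ^ 'i) set" where
  "cell n t = {X. \<forall>i. discretize n (X $ i) = t i}"

lemma sets_cell [measurable]:
  "cell n t \<in> sets (borel :: ('a::second_countable_topology ^ 'i::finite) measure)"
proof -
  have "{X \<in> space borel. \<forall>i. discretize n (X $ i :: 'a) = t i} \<in> sets (borel :: ('a ^ 'i) measure)"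
    by measurable
  thus ?thesis by (simp add: cell_def)
qed

lemma distr_sequence_eqI:
  fixes Y :: "'a \<Rightarrow> nat \<Rightarrow> 'c::topological_space" and Z :: "'b \<Rightarrow> nat \<Rightarrow> 'c"
  assumes "prob_space M" "prob_space N"
    and Y: "Y \<in> measurable M (PiM UNIV (\<lambda>_ :: nat. borel))"
    and Z: "Z \<in> measurable N (PiM UNIV (\<lambda>_. borel))"
    and cylinders: "\<And>J A. finite J \<Longrightarrow> (\<And>k. k \<in> J \<Longrightarrow> A k \<in> sets borel) \<Longrightarrow>
      measure M {\<omega>\<in>space M. \<forall>k\<in>J. Y \<omega> k \<in> A k} = measure N {x\<in>space N. \<forall>k\<in>J. Z x k \<in> A k}"
  shows "distr M (PiM UNIV (\<lambda>_. borel)) Y = distr N (PiM UNIV (\<lambda>_. borel)) Z"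
proof (rule measure_eqI_PiM_infinite)
  interpret M: prob_space M by fact
  interpret N: prob_space N by fact
  show "finite_measure (distr M (PiM UNIV (\<lambda>_. borel)) Y)" by (rule M.finite_measure_distr[OF Y])
  fix J and A :: "nat \<Rightarrow> 'c set"
  assume J: "finite J" and A: "\<And>k. k \<in> J \<Longrightarrow> A k \<in> sets borel"
  let ?C = "prod_emb UNIV (\<lambda>_. borel) J (Pi\<^sub>E J A)"
  have C: "?C \<in> sets (PiM UNIV (\<lambda>_. borel))" using J A by (intro sets_PiM_I) auto
  have "f -` ?C \<inter> S = {x\<in>S. \<forall>k\<in>J. f x k \<in> A k}" for f :: "'a \<Rightarrow> nat \<Rightarrow> 'c" and S
    by (auto simp: prod_emb_def)
  moreover have "g -` ?C \<inter> S = {x\<in>S. \<forall>k\<in>J. g x k \<in> A k}" for g :: "'b \<Rightarrow> nat \<Rightarrow> 'c" and S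
    by (auto simp: prod_emb_def)
  ultimately show "emeasure (distr M (PiM UNIV (\<lambda>_. borel)) Y) ?C =
      emeasure (distr N (PiM UNIV (\<lambda>_. borel)) Z) ?C"
    using cylinders[OF J A]
    by (simp add: emeasure_distr[OF Y C] emeasure_distr[OF Z C]
        M.emeasure_eq_measure N.emeasure_eq_measure)
qed auto

lemma prob_discretized_coupling_nth:
  assumes prob: "prob_space \<mu>" and \<mu>: "sets \<mu> = sets borel"
    and \<gamma>: "map_pmf (\<lambda>X. X $ i) \<gamma> = discretized_pmf n \<mu>" and J: "\<And>k. k \<in> J \<Longrightarrow> k \<le> n"
  shows "measure_pmf.prob \<gamma> {X. \<forall>k\<in>J. discretize k (X $ i) \<in> A k} =
    measure \<mu> {x\<in>space \<mu>. \<forall>k\<in>J. discretize k x \<in> A k}"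
proof -
  note \<mu>[measurable_cong]
  let ?E = "{x. \<forall>k\<in>J. discretize k x \<in> A k}"
  have "measure_pmf.prob \<gamma> {X. \<forall>k\<in>J. discretize k (X $ i) \<in> A k} =
      measure_pmf.prob (discretized_pmf n \<mu>) ?E"
    unfolding \<gamma>[symmetric] by (simp add: vimage_def)
  also have "\<dots> = measure \<mu> (discretize n -` ?E \<inter> space \<mu>)"
    unfolding measure_pmf_discretized_pmf[OF prob \<mu>] by (rule measure_distr) measurable
  also have "discretize n -` ?E \<inter> space \<mu> = {x\<in>space \<mu>. \<forall>k\<in>J. discretize k x \<in> A k}"
    using J by (auto simp: discretize_discretize)
  finally show ?thesis .
qed

definition discretizations :: "'a::second_countable_topology ^ 'i \<Rightarrow> 'i \<times> nat \<Rightarrow> 'a" where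
  "discretizations X = (\<lambda>(i, n). discretize n (X $ i))"

text \<open>The prescribed marginals determine the laws of the coordinates of the limit process. Almost surely
  each coordinate therefore consists of the discretisations of a point, which replaces tightness.\<close>

lemma distr_coordinate_of_limit:
  fixes \<mu> :: "'i::finite \<Rightarrow> 'a::euclidean_space measure" and \<gamma> :: "nat \<Rightarrow> ('a ^ 'i) pmf"
  assumes prob: "\<And>i. prob_space (\<mu> i)" and \<mu>: "\<And>i. sets (\<mu> i) = sets borel"
    and \<gamma>: "\<And>n. \<gamma> n \<in> pmf_couplings (\<lambda>i. discretized_pmf n (\<mu> i))" and r: "strict_mono r"
    and M: "finite_dimensional_limit (\<lambda>n. map_pmf discretizations (\<gamma> (r n))) M"
  shows "distr M (PiM UNIV (\<lambda>_. borel)) (\<lambda>\<omega> n. \<omega> (i, n)) =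
    distr (\<mu> i) (PiM UNIV (\<lambda>_. borel)) (\<lambda>x n. discretize n x)"
proof (rule distr_sequence_eqI)
  show "prob_space M" using M by (simp add: finite_dimensional_limit_def)
  have sets_M [measurable_cong]: "sets M = sets (PiM UNIV (\<lambda>_. borel))"
    using M by (simp add: finite_dimensional_limit_def)
  show "(\<lambda>\<omega> n. \<omega> (i, n)) \<in> measurable M (PiM UNIV (\<lambda>_. borel))"
    by (rule measurable_PiM_single') auto
  show "(\<lambda>x n. discretize n x) \<in> measurable (\<mu> i) (PiM UNIV (\<lambda>_. borel))"
    by (simp add: measurable_cong_sets[OF \<mu> refl] measurable_discretize_sequence)
  fix J :: "nat set" and A :: "nat \<Rightarrow> 'a set"
  assume J: "finite J" and A: "\<And>k. k \<in> J \<Longrightarrow> A k \<in> sets borel"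
  let ?C = "Pi ({i} \<times> J) (\<lambda>(i, k). A k)"
  let ?prob = "\<lambda>n. measure_pmf.prob (map_pmf discretizations (\<gamma> (r n))) ?C"
  let ?E = "{x\<in>space (\<mu> i). \<forall>k\<in>J. discretize k x \<in> A k}"
  have C: "?C = {\<omega>. \<forall>k\<in>J. \<omega> (i, k) \<in> A k}" by auto
  have "?prob \<longlonglongrightarrow> measure M ?C"
    using M J A unfolding finite_dimensional_limit_def by simp
  moreover have "?prob \<longlonglongrightarrow> measure (\<mu> i) ?E"
  proof (rule tendsto_eventually)
    have "\<forall>\<^sub>F n in sequentially. \<forall>k\<in>J. k \<le> r n"
      using filterlim_subseq[OF r]
      by (intro eventually_ball_finite[OF J]) (simp add: filterlim_at_top)
    thus "\<forall>\<^sub>F n in sequentially. ?prob n = measure (\<mu> i) ?E"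
      by eventually_elim
         (simp add: C vimage_def discretizations_def
           prob_discretized_coupling_nth[OF prob \<mu> pmf_coupling_nth[OF \<gamma>]])
  qed
  ultimately show "measure M {\<omega>\<in>space M. \<forall>k\<in>J. \<omega> (i, k) \<in> A k} = measure (\<mu> i) ?E"
    using LIMSEQ_unique sets_eq_imp_space_eq[OF sets_M] by (simp add: C space_PiM)
qed (rule prob)

lemma ex_coupling_of_process:
  fixes \<mu> :: "'i::finite \<Rightarrow> 'a::euclidean_space measure"
  assumes "prob_space M" and M: "sets M = sets (PiM (UNIV :: ('i \<times> nat) set) (\<lambda>_. borel))"
    and \<mu>: "\<And>i. sets (\<mu> i) = sets borel"
    and law: "\<And>i. distr M (PiM UNIV (\<lambda>_. borel)) (\<lambda>\<omega> n. \<omega> (i, n)) =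
      distr (\<mu> i) (PiM UNIV (\<lambda>_. borel)) (\<lambda>x n. discretize n x)"
  shows "\<exists>\<rho>\<in>marginal_couplings \<mu>. \<forall>n t. measure \<rho> (cell n t) = measure M {\<omega>. \<forall>i. \<omega> (i, n) = t i}"
proof -
  interpret prob_space M by fact
  note M[measurable_cong]
  have coord_meas: "(\<lambda>\<omega> n. \<omega> (i, n)) \<in> measurable M (PiM UNIV (\<lambda>_. borel))" for i
    by (rule measurable_PiM_single') auto
  define R :: "('i \<times> nat \<Rightarrow> 'a) \<Rightarrow> 'a ^ 'i" where "R = (\<lambda>\<omega>. \<chi> i. lim (\<lambda>n. \<omega> (i, n)))"
  have R_nth_meas: "(\<lambda>\<omega>. R \<omega> $ i) \<in> borel_measurable M" for i
    using measurable_compose[OF coord_meas borel_measurable_lim_sequence, of i] by (simp add: R_def)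
  have R_meas [measurable]: "R \<in> borel_measurable M"
    by (rule borel_measurable_vecI) (rule R_nth_meas)
  have "distr (distr M borel R) borel (\<lambda>X. X $ i) = \<mu> i" for i
    using distr_lim_discretizations[OF coord_meas \<mu> law, of i]
    by (subst distr_distr[OF borel_measurable_vec_nth R_meas]) (simp add: o_def R_def)
  hence "distr M borel R \<in> marginal_couplings \<mu>"
    by (simp add: marginal_couplings_def prob_space_distr)
  moreover have "measure (distr M borel R) (cell n t) = measure M {\<omega>. \<forall>i. \<omega> (i, n) = t i}" for n t
  proof -
    have "measure (distr M borel R) (cell n t) = measure M {\<omega>\<in>space M. R \<omega> \<in> cell n t}"
      by (subst measure_distr) (auto simp: vimage_def Int_def conj_commute)
    also have "\<dots> = measure M {\<omega>\<in>space M. \<forall>i. \<omega> (i, n) = t i}"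
    proof (rule finite_measure_eq_AE)
      have "AE \<omega> in M. \<forall>i. discretize n (R \<omega> $ i) = \<omega> (i, n)"
        using AE_discretize_lim_discretizations[OF coord_meas \<mu> law]
        by (auto simp: AE_all_countable R_def)
      thus "AE \<omega> in M. \<omega> \<in> {\<omega>\<in>space M. R \<omega> \<in> cell n t} \<longleftrightarrow> \<omega> \<in> {\<omega>\<in>space M. \<forall>i. \<omega> (i, n) = t i}"
        by eventually_elim (simp add: cell_def)
    qed measurable
    finally show ?thesis using sets_eq_imp_space_eq[OF M] by (simp add: space_PiM)
  qed
  ultimately show ?thesis by blast
qed

lemma ex_limit_coupling:
  fixes \<mu> :: "'i::finite \<Rightarrow> 'a::euclidean_space measure" and \<gamma> :: "nat \<Rightarrow> ('a ^ 'i) pmf"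
  assumes prob: "\<And>i. prob_space (\<mu> i)" and \<mu>: "\<And>i. sets (\<mu> i) = sets borel"
    and \<gamma>: "\<And>n. \<gamma> n \<in> pmf_couplings (\<lambda>i. discretized_pmf n (\<mu> i))"
  shows "\<exists>\<rho>\<in>marginal_couplings \<mu>. \<exists>r. strict_mono r \<and>
     (\<forall>N t. (\<lambda>n. measure_pmf.prob (\<gamma> (r n)) (cell N t)) \<longlonglongrightarrow> measure \<rho> (cell N t))"
proof -
  have "\<exists>r M. strict_mono r \<and> finite_dimensional_limit (\<lambda>n. map_pmf discretizations (\<gamma> (r n))) M"
    by (rule ex_finite_dimensional_limit[where S = "\<lambda>(i, n). range (discretize n)"])
       (auto simp: discretizations_def finite_range_discretize)
  then obtain r M where r: "strict_mono r"
    and lim: "finite_dimensional_limit (\<lambda>n. map_pmf discretizations (\<gamma> (r n))) M" by blast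
  have M: "prob_space M" "sets M = sets (PiM UNIV (\<lambda>_. borel))"
    using lim by (simp_all add: finite_dimensional_limit_def)
  have "\<exists>\<rho>\<in>marginal_couplings \<mu>. \<forall>n t. measure \<rho> (cell n t) = measure M {\<omega>. \<forall>i. \<omega> (i, n) = t i}"
    by (rule ex_coupling_of_process[OF M \<mu> distr_coordinate_of_limit[OF prob \<mu> \<gamma> r lim]])
  then obtain \<rho> where \<rho>: "\<rho> \<in> marginal_couplings \<mu>"
    and cells: "\<And>n t. measure \<rho> (cell n t) = measure M {\<omega>. \<forall>i. \<omega> (i, n) = t i}" by blast
  have "(\<lambda>n. measure_pmf.prob (\<gamma> (r n)) (cell N t)) \<longlonglongrightarrow> measure \<rho> (cell N t)" for N t
  proof -
    let ?C = "Pi (UNIV \<times> {N}) (\<lambda>(i, k). {t i})"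
    have C: "?C = {\<omega>. \<forall>i. \<omega> (i, N) = t i}" by auto
    have "(\<lambda>n. measure_pmf.prob (map_pmf discretizations (\<gamma> (r n))) ?C) \<longlonglongrightarrow> measure M ?C"
      using lim unfolding finite_dimensional_limit_def by simp
    thus ?thesis unfolding cells by (simp add: C cell_def vimage_def discretizations_def)
  qed
  thus ?thesis using \<rho> r by blast
qed

section \<open>Epigraphical limits\<close>

definition epi_limit :: "(nat \<Rightarrow> 'a::second_countable_topology \<Rightarrow> ereal) \<Rightarrow> 'a \<Rightarrow> ereal" where
  "epi_limit f x = (SUP k\<in>{k. x \<in> basic_open k}. lim (\<lambda>n. INF y\<in>basic_open k. f n y))"

definition epi_convergent :: "(nat \<Rightarrow> 'a::second_countable_topology \<Rightarrow> ereal) \<Rightarrow> bool" where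
  "epi_convergent f \<longleftrightarrow> (\<forall>k. convergent (\<lambda>n. INF y\<in>basic_open k. f n y))"

lemma ex_epi_convergent_subsequence:
  fixes f :: "nat \<Rightarrow> 'i::countable \<Rightarrow> 'a::second_countable_topology \<Rightarrow> ereal"
  shows "\<exists>r. strict_mono r \<and> (\<forall>i. epi_convergent (\<lambda>n. f (r n) i))"
  using convergent_subsequence_countable[OF countableI_type[of UNIV],
      of "\<lambda>n (i, k). INF y\<in>basic_open k. f n i y"]
  by (auto simp: epi_convergent_def convergent_def)

lemma lower_semicontinuous_epi_limit: "lower_semicontinuous (epi_limit f)"
  unfolding lower_semicontinuous_def
proof
  fix t
  have "{x. t < epi_limit f x} =
      (\<Union>k\<in>{k. t < lim (\<lambda>n. INF y\<in>basic_open k. f n y)}. basic_open k)"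
    by (auto simp: epi_limit_def less_SUP_iff)
  thus "open {x. t < epi_limit f x}" by auto
qed

lemma epi_limit_less_imp_eventually_ex:
  assumes conv: "epi_convergent f" and limit_less: "epi_limit f x < t" and V: "open V" "x \<in> V"
  shows "\<forall>\<^sub>F n in sequentially. \<exists>y\<in>V. f n y < t"
proof -
  obtain k where k: "x \<in> basic_open k" "basic_open k \<subseteq> V" using ex_basic_open[OF V] by blast
  let ?inf = "\<lambda>n. INF y\<in>basic_open k. f n y"
  have "lim ?inf \<le> epi_limit f x" unfolding epi_limit_def by (rule SUP_upper) (use k in simp)
  hence "lim ?inf < t" using limit_less by (rule le_less_trans)
  moreover have "?inf \<longlonglongrightarrow> lim ?inf" using conv by (simp add: epi_convergent_def convergent_LIMSEQ_iff)
  ultimately have "\<forall>\<^sub>F n in sequentially. ?inf n < t" by (rule order_tendstoD(2)[rotated])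
  thus ?thesis by eventually_elim (use k(2) in \<open>auto simp: INF_less_iff\<close>)
qed

lemma less_epi_limit_imp_eventually_less:
  assumes conv: "epi_convergent f" and less_limit: "t < epi_limit f x"
  shows "\<exists>V. open V \<and> x \<in> V \<and> (\<forall>\<^sub>F n in sequentially. \<forall>y\<in>V. t < f n y)"
proof -
  obtain k where k: "x \<in> basic_open k" "t < lim (\<lambda>n. INF y\<in>basic_open k. f n y)"
    using less_limit by (auto simp: epi_limit_def less_SUP_iff)
  let ?inf = "\<lambda>n. INF y\<in>basic_open k. f n y"
  have "?inf \<longlonglongrightarrow> lim ?inf" using conv by (simp add: epi_convergent_def convergent_LIMSEQ_iff)
  hence "\<forall>\<^sub>F n in sequentially. t < ?inf n" using k(2) by (rule order_tendstoD)
  hence "\<forall>\<^sub>F n in sequentially. \<forall>y\<in>basic_open k. t < f n y"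
    by eventually_elim (auto intro: less_le_trans INF_lower)
  thus ?thesis using k(1) by (intro exI[of _ "basic_open k"]) simp
qed

lemma le_epi_limit:
  assumes conv: "epi_convergent f" and V: "open V" "x \<in> V"
    and lower: "\<forall>\<^sub>F n in sequentially. \<forall>y\<in>V. t \<le> f n y"
  shows "t \<le> epi_limit f x"
proof (rule ccontr)
  assume "\<not> t \<le> epi_limit f x"
  hence "\<forall>\<^sub>F n in sequentially. \<exists>y\<in>V. f n y < t"
    by (intro epi_limit_less_imp_eventually_ex[OF conv _ V]) simp
  hence "\<forall>\<^sub>F n :: nat in sequentially. False" using lower by eventually_elim (auto simp: not_less)
  thus False by simp
qed

lemma sum_epi_limit_ge:
  fixes f :: "nat \<Rightarrow> 'i::finite \<Rightarrow> 'a::second_countable_topology \<Rightarrow> ereal"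
  assumes cont: "continuous_on UNIV c" and conv: "\<And>i. epi_convergent (\<lambda>n. f n i)"
    and dominated: "\<And>n X. ereal (c X) \<le> (\<Sum>i\<in>UNIV. f n i (X $ i))"
    and neq: "\<And>i x. epi_limit (\<lambda>n. f n i) x \<noteq> -\<infinity>"
  shows "ereal (c X) \<le> (\<Sum>i\<in>UNIV. epi_limit (\<lambda>n. f n i) (X $ i))"
proof (rule ccontr)
  let ?\<Phi> = "\<lambda>i. epi_limit (\<lambda>n. f n i) (X $ i)"
  assume "\<not> ?thesis"
  hence sum_less: "(\<Sum>i\<in>UNIV. ?\<Phi> i) < ereal (c X)" by simp
  then obtain s where s: "(\<Sum>i\<in>UNIV. ?\<Phi> i) = ereal s"
    using sum_ereal_neq_MInfty[of UNIV ?\<Phi>] neq by (cases "\<Sum>i\<in>UNIV. ?\<Phi> i") auto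
  define v where "v = (\<lambda>i. real_of_ereal (?\<Phi> i))"
  have v: "?\<Phi> i = ereal (v i)" for i
    unfolding v_def by (rule sum_eq_ereal_imp_real[OF s neq])
  have "sum v UNIV < c X" using sum_less by (simp add: v)
  define e where "e = (c X - sum v UNIV) / 2"
  have e_props: "e > 0" "c X - e = sum v UNIV + e"
    using \<open>sum v UNIV < c X\<close> by (auto simp: e_def field_simps)
  define d where "d = e / CARD('i)"
  have "open {Y. c X - e < c Y}" by (rule open_Collect_less[OF continuous_on_const cont])
  then obtain W where W: "\<And>i. open (W i)" "X \<in> Pi_vec W" "Pi_vec W \<subseteq> {Y. c X - e < c Y}"
    using open_vec_contains_box[of "{Y. c X - e < c Y}" X] e_props(1) by auto
  have "\<forall>\<^sub>F n in sequentially. \<exists>y\<in>W i. f n i y < ereal (v i + d)" for i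
    using W(1,2) e_props(1)
    by (intro epi_limit_less_imp_eventually_ex[OF conv, of _ "X $ i"]) (auto simp: v d_def)
  hence "\<forall>\<^sub>F n in sequentially. \<forall>i. \<exists>y\<in>W i. f n i y < ereal (v i + d)"
    by (rule eventually_all_finite)
  then obtain n where "\<forall>i. \<exists>y\<in>W i. f n i y < ereal (v i + d)"
    using eventually_happens'[OF sequentially_bot] by blast
  then obtain y where y: "\<And>i. y i \<in> W i" "\<And>i. f n i (y i) < ereal (v i + d)" by metis
  let ?Y = "\<chi> i. y i"
  have "ereal (c ?Y) \<le> (\<Sum>i\<in>UNIV. f n i (?Y $ i))" by (rule dominated)
  also have "\<dots> \<le> (\<Sum>i\<in>UNIV. ereal (v i + d))"
    using y(2) by (intro sum_mono) (simp only: vec_lambda_beta less_imp_le)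
  finally have "c ?Y \<le> c X - e" using e_props(2) by (simp add: sum.distrib d_def)
  moreover have "?Y \<in> Pi_vec W" using y(1) by simp
  hence "c X - e < c ?Y" using W(3) by blast
  ultimately show False by simp
qed

definition asymptotically_tight ::
    "('a::topological_space ^ 'i::finite \<Rightarrow> real) \<Rightarrow> (nat \<Rightarrow> 'i \<Rightarrow> 'a \<Rightarrow> ereal) \<Rightarrow> 'a ^ 'i \<Rightarrow> bool" where
  "asymptotically_tight c f X \<longleftrightarrow> (\<forall>V e. open V \<longrightarrow> X \<in> V \<longrightarrow> 0 < e \<longrightarrow>
     (\<forall>\<^sub>F n in sequentially. \<exists>Y\<in>V. (\<Sum>i\<in>UNIV. f n i (Y $ i)) \<le> ereal (c Y + e)))"

lemma asymptotically_tightD: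
  assumes "asymptotically_tight c f X" "open V" "X \<in> V" "0 < e"
  shows "\<forall>\<^sub>F n in sequentially. \<exists>Y\<in>V. (\<Sum>i\<in>UNIV. f n i (Y $ i)) \<le> ereal (c Y + e)"
  using assms unfolding asymptotically_tight_def by blast

lemma asymptotically_tight_subseq:
  assumes "asymptotically_tight c f X" "strict_mono r"
  shows "asymptotically_tight c (\<lambda>n. f (r n)) X"
  using assms unfolding asymptotically_tight_def by (auto intro: eventually_subseq)

lemma ereal_less_add_imp_split:
  assumes "ereal t < x + y" "x \<noteq> -\<infinity>" "y \<noteq> -\<infinity>"
  shows "\<exists>s u. ereal s < x \<and> ereal u < y \<and> t < s + u"
proof -
  have "ereal t - y < x" using assms by (cases x; cases y) auto
  then obtain s where s: "ereal t - y < ereal s" "ereal s < x" using ereal_dense2 by blast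
  hence "ereal (t - s) < y" using assms by (cases y) auto
  then obtain u where "ereal (t - s) < ereal u" "ereal u < y" using ereal_dense2 by blast
  thus ?thesis using s by (intro exI[of _ s] exI[of _ u]) auto
qed

lemma ereal_less_sum_imp_split:
  fixes f :: "'i \<Rightarrow> ereal"
  assumes "finite I" "ereal t < sum f I" "\<And>i. i \<in> I \<Longrightarrow> f i \<noteq> -\<infinity>"
  shows "\<exists>b. (\<forall>i\<in>I. ereal (b i) < f i) \<and> t < sum b I"
  using assms
proof (induction I arbitrary: t)
  case (insert j I)
  have "sum f I \<noteq> -\<infinity>" using insert.prems(2) by (intro sum_ereal_neq_MInfty) auto
  then obtain s u where su: "ereal s < f j" "ereal u < sum f I" "t < s + u"
    using ereal_less_add_imp_split[of t "f j" "sum f I"] insert by auto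
  obtain b where b: "\<forall>i\<in>I. ereal (b i) < f i" "u < sum b I"
    using insert.IH[OF su(2)] insert.prems(2) by auto
  have "sum (b(j := s)) I = sum b I" using insert.hyps by (intro sum.cong) auto
  thus ?case using su b insert.hyps by (intro exI[of _ "b(j := s)"]) auto
qed simp

lemma sum_epi_limit_le:
  fixes f :: "nat \<Rightarrow> 'i::finite \<Rightarrow> 'a::second_countable_topology \<Rightarrow> ereal"
  assumes cont: "continuous_on UNIV c" and conv: "\<And>i. epi_convergent (\<lambda>n. f n i)"
    and neq: "\<And>i x. epi_limit (\<lambda>n. f n i) x \<noteq> -\<infinity>" and tight: "asymptotically_tight c f X"
  shows "(\<Sum>i\<in>UNIV. epi_limit (\<lambda>n. f n i) (X $ i)) \<le> ereal (c X)"
proof (rule ccontr)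
  let ?\<Phi> = "\<lambda>i. epi_limit (\<lambda>n. f n i) (X $ i)"
  assume "\<not> ?thesis"
  then obtain b where b: "\<And>i. ereal (b i) < ?\<Phi> i" "c X < sum b UNIV"
    using ereal_less_sum_imp_split[of UNIV "c X" ?\<Phi>] neq by (auto simp: not_le)
  define e where "e = (sum b UNIV - c X) / 2"
  have e_props: "e > 0" "c X + e + e = sum b UNIV" using b(2) by (auto simp: e_def field_simps)
  have "\<exists>V. \<forall>i. open (V i) \<and> X $ i \<in> V i \<and> (\<forall>\<^sub>F n in sequentially. \<forall>y\<in>V i. ereal (b i) < f n i y)"
    by (intro choice allI less_epi_limit_imp_eventually_less[OF conv b(1)])
  then obtain V where V: "\<And>i. open (V i)" "\<And>i. X $ i \<in> V i"
    "\<And>i. \<forall>\<^sub>F n in sequentially. \<forall>y\<in>V i. ereal (b i) < f n i y" by blast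
  let ?V = "Pi_vec V \<inter> {Y. c Y < c X + e}"
  have "open {Y. c Y < c X + e}" by (rule open_Collect_less[OF cont continuous_on_const])
  hence "open ?V" using V(1) by (auto simp: Pi_vec_def intro!: open_vector_box)
  moreover have "X \<in> ?V" using V(2) e_props(1) by simp
  ultimately have "\<forall>\<^sub>F n in sequentially. \<exists>Y\<in>?V. (\<Sum>i\<in>UNIV. f n i (Y $ i)) \<le> ereal (c Y + e)"
    using asymptotically_tightD[OF tight _ _ e_props(1)] by blast
  moreover have "\<forall>\<^sub>F n in sequentially. \<forall>i. \<forall>y\<in>V i. ereal (b i) < f n i y"
    by (rule eventually_all_finite) (rule V(3))
  ultimately have "\<forall>\<^sub>F n :: nat in sequentially. False"
  proof eventually_elim
    case (elim n)
    then obtain Y where Y: "Y \<in> ?V" "(\<Sum>i\<in>UNIV. f n i (Y $ i)) \<le> ereal (c Y + e)" by blast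
    have "(\<Sum>i\<in>UNIV. ereal (b i)) \<le> (\<Sum>i\<in>UNIV. f n i (Y $ i))"
      using elim Y(1) by (intro sum_mono less_imp_le) auto
    also have "\<dots> \<le> ereal (c Y + e)" by (rule Y(2))
    finally have "sum b UNIV \<le> c Y + e" by simp
    thus False using Y(1) e_props by simp
  qed
  thus False by simp
qed

section \<open>Limits of asymptotically tight admissible potentials\<close>

lemma sum_add_ereal_shift:
  fixes f :: "'i::finite \<Rightarrow> ereal"
  assumes "sum a UNIV = 0"
  shows "(\<Sum>i\<in>UNIV. f i + ereal (a i)) = (\<Sum>i\<in>UNIV. f i)"
  using assms by (simp add: sum.distrib)

lemma ex_normalizing_shift:
  fixes \<phi> :: "'i::finite \<Rightarrow> 'a::topological_space \<Rightarrow> ereal"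
  assumes \<phi>: "\<phi> \<in> admissible c" and Y: "(\<Sum>i\<in>UNIV. \<phi> i (Y $ i)) \<le> ereal (c Y + 1)"
  shows "\<exists>a. sum a UNIV = 0 \<and> (\<forall>i x. ereal (c (vec_upd Y i x) - \<bar>c Y\<bar> - 1) \<le> \<phi> i x + ereal (a i))"
proof -
  obtain T where T: "(\<Sum>i\<in>UNIV. \<phi> i (Y $ i)) = ereal T"
    using Y admissibleD(3)[OF \<phi>, of Y] by (cases "\<Sum>i\<in>UNIV. \<phi> i (Y $ i)") auto
  hence T_bounds: "\<bar>T\<bar> \<le> \<bar>c Y\<bar> + 1" using Y admissibleD(3)[OF \<phi>, of Y] by auto
  define v where "v = (\<lambda>i. real_of_ereal (\<phi> i (Y $ i)))"
  have v: "\<phi> i (Y $ i) = ereal (v i)" for i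
    unfolding v_def by (rule potential_eq_real_of_sum_eq_ereal[OF \<phi> T])
  have sum_v: "sum v UNIV = T" using T by (simp add: v)
  let ?N = "real CARD('i)"
  define a where "a = (\<lambda>i. T / ?N - v i)"
  have sum_a: "sum a UNIV = 0" by (simp add: a_def sum_subtractf sum_v)
  have "ereal (c (vec_upd Y i x) - \<bar>c Y\<bar> - 1) \<le> \<phi> i x + ereal (a i)" for i x
  proof -
    have "ereal (c (vec_upd Y i x)) \<le> (\<Sum>j\<in>UNIV. \<phi> j (vec_upd Y i x $ j) + ereal (a j))"
      unfolding sum_add_ereal_shift[OF sum_a] by (rule admissibleD(3)[OF \<phi>])
    also have "\<dots> = (\<phi> i x + ereal (a i)) + (\<Sum>j\<in>UNIV-{i}. \<phi> j (Y $ j) + ereal (a j))"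
      by (rule sum_vec_upd)
    also have "(\<Sum>j\<in>UNIV-{i}. \<phi> j (Y $ j) + ereal (a j)) = ereal ((?N - 1) / ?N * T)"
      by (simp add: v a_def card_Diff_singleton)
    finally have "ereal (c (vec_upd Y i x) - (?N - 1) / ?N * T) \<le> \<phi> i x + ereal (a i)"
      by (cases "\<phi> i x") auto
    moreover have "(?N - 1) / ?N * T \<le> \<bar>c Y\<bar> + 1"
    proof -
      have "(?N - 1) / ?N * T \<le> (?N - 1) / ?N * \<bar>T\<bar>" by (intro mult_left_mono) auto
      also have "\<dots> \<le> 1 * \<bar>T\<bar>" by (intro mult_right_mono) auto
      finally show ?thesis using T_bounds by simp
    qed
    ultimately show ?thesis by (elim order_trans[rotated]) simp
  qed
  thus ?thesis using sum_a by blast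
qed

lemma continuous_vec_upd_bounded_below:
  fixes c :: "'a::euclidean_space ^ 'i::finite \<Rightarrow> real"
  assumes cont: "continuous_on UNIV c"
  shows "\<exists>L. \<forall>Y\<in>ball X 1. \<forall>y\<in>ball x 1. L \<le> c (vec_upd Y i y) - \<bar>c Y\<bar> - 1"
proof -
  let ?K = "cball X 1 \<times> cball x 1" and ?F = "\<lambda>p. c (vec_upd (fst p) i (snd p)) - \<bar>c (fst p)\<bar> - 1"
  have "continuous_on ?K ?F"
    by (intro continuous_intros continuous_on_compose2[OF cont] continuous_on_vec_upd subset_UNIV)
  moreover have "compact ?K" "?K \<noteq> {}" by (auto intro: compact_Times)
  ultimately obtain p where "\<forall>q\<in>?K. ?F p \<le> ?F q" using continuous_attains_inf by blast
  thus ?thesis by (intro exI[of _ "?F p"]) auto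
qed

text \<open>Constants are shifted between the potentials to make them locally bounded from below.\<close>

lemma ex_locally_bounded_shift:
  fixes f :: "nat \<Rightarrow> 'i::finite \<Rightarrow> 'a::euclidean_space \<Rightarrow> ereal"
  assumes cont: "continuous_on UNIV c" and adm: "\<And>n. f n \<in> admissible c"
    and tight: "asymptotically_tight c f X"
  shows "\<exists>a. (\<forall>n. sum (a n) UNIV = 0) \<and> (\<forall>i x. \<exists>L. \<forall>\<^sub>F n in sequentially.
      \<forall>y\<in>ball x 1. ereal L \<le> f n i y + ereal (a n i))"
proof -
  let ?near = "\<lambda>n. \<exists>Y\<in>ball X 1. (\<Sum>i\<in>UNIV. f n i (Y $ i)) \<le> ereal (c Y + 1)"
  let ?lower = "\<lambda>n a. \<exists>Y\<in>ball X 1. \<forall>i x.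
    ereal (c (vec_upd Y i x) - \<bar>c Y\<bar> - 1) \<le> f n i x + ereal (a i)"
  have "\<exists>a. sum a UNIV = 0 \<and> (?near n \<longrightarrow> ?lower n a)" for n
  proof (cases "?near n")
    case True
    thus ?thesis using ex_normalizing_shift[OF adm] by blast
  next
    case False
    thus ?thesis by (intro exI[of _ "\<lambda>_. 0"]) simp
  qed
  then obtain a where a: "\<And>n. sum (a n) UNIV = 0" and lower: "\<And>n. ?near n \<Longrightarrow> ?lower n (a n)"
    by metis
  have near: "\<forall>\<^sub>F n in sequentially. ?near n"
    by (rule asymptotically_tightD[OF tight]) auto
  have "\<exists>L. \<forall>\<^sub>F n in sequentially. \<forall>y\<in>ball x 1. ereal L \<le> f n i y + ereal (a n i)" for i x
  proof -
    obtain L where L: "\<forall>Y\<in>ball X 1. \<forall>y\<in>ball x 1. L \<le> c (vec_upd Y i y) - \<bar>c Y\<bar> - 1"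
      using continuous_vec_upd_bounded_below[OF cont] by blast
    have "ereal L \<le> f n i y + ereal (a n i)" if "?near n" "y \<in> ball x 1" for n y
    proof -
      obtain Y where Y: "Y \<in> ball X 1"
        "ereal (c (vec_upd Y i y) - \<bar>c Y\<bar> - 1) \<le> f n i y + ereal (a n i)"
        using lower[OF \<open>?near n\<close>] by blast
      have "ereal L \<le> ereal (c (vec_upd Y i y) - \<bar>c Y\<bar> - 1)" using L Y(1) \<open>y \<in> ball x 1\<close> by simp
      thus ?thesis using Y(2) by (rule order_trans)
    qed
    hence "\<forall>\<^sub>F n in sequentially. \<forall>y\<in>ball x 1. ereal L \<le> f n i y + ereal (a n i)"
      by (intro eventually_mono[OF near] ballI)
    thus ?thesis ..
  qed
  thus ?thesis using a by blast
qed

lemma ex_tight_limit_potentials: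
  fixes f :: "nat \<Rightarrow> 'i::finite \<Rightarrow> 'a::euclidean_space \<Rightarrow> ereal"
  assumes cont: "continuous_on UNIV c" and adm: "\<And>n. f n \<in> admissible c"
    and X0: "asymptotically_tight c f X0"
  shows "\<exists>\<phi>\<in>admissible c. \<forall>X. asymptotically_tight c f X \<longrightarrow> (\<Sum>i\<in>UNIV. \<phi> i (X $ i)) = ereal (c X)"
proof -
  obtain a where a: "\<And>n. sum (a n) UNIV = 0"
    and lower: "\<And>i x. \<exists>L. \<forall>\<^sub>F n in sequentially. \<forall>y\<in>ball x 1. ereal L \<le> f n i y + ereal (a n i)"
    using ex_locally_bounded_shift[OF cont adm X0] by blast
  obtain r where r: "strict_mono r"
    and conv: "\<And>i. epi_convergent (\<lambda>n y. f (r n) i y + ereal (a (r n) i))"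
    using ex_epi_convergent_subsequence[of "\<lambda>n i y. f n i y + ereal (a n i)"] by blast
  define g where "g = (\<lambda>n i y. f (r n) i y + ereal (a (r n) i))"
  have g_conv: "epi_convergent (\<lambda>n. g n i)" for i using conv by (simp add: g_def)
  have g_sum: "(\<Sum>i\<in>UNIV. g n i (X $ i)) = (\<Sum>i\<in>UNIV. f (r n) i (X $ i))" for n X
    unfolding g_def by (rule sum_add_ereal_shift[OF a])
  have g_tight: "asymptotically_tight c g X" if "asymptotically_tight c f X" for X
    using asymptotically_tight_subseq[OF that r] by (simp add: asymptotically_tight_def g_sum)
  let ?\<phi> = "\<lambda>i. epi_limit (\<lambda>n. g n i)"
  have neq: "?\<phi> i x \<noteq> -\<infinity>" for i x
  proof -
    obtain L where "\<forall>\<^sub>F n in sequentially. \<forall>y\<in>ball x 1. ereal L \<le> f n i y + ereal (a n i)"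
      using lower by blast
    from eventually_subseq[OF r this] have "ereal L \<le> ?\<phi> i x"
      by (intro le_epi_limit[OF g_conv, of "ball x 1"]) (auto simp: g_def)
    thus ?thesis by auto
  qed
  have sum_ge: "ereal (c X) \<le> (\<Sum>i\<in>UNIV. ?\<phi> i (X $ i))" for X
    by (rule sum_epi_limit_ge[OF cont g_conv _ neq]) (simp add: g_sum admissibleD(3)[OF adm])
  hence "?\<phi> \<in> admissible c" by (intro admissibleI lower_semicontinuous_epi_limit neq)
  moreover have "(\<Sum>i\<in>UNIV. ?\<phi> i (X $ i)) = ereal (c X)" if "asymptotically_tight c f X" for X
    by (rule antisym[OF sum_epi_limit_le[OF cont g_conv neq g_tight[OF that]] sum_ge])
  ultimately show ?thesis by (intro bexI[of _ ?\<phi>] allI impI)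
qed

section \<open>Existence of tight couplings\<close>

lemma AE_positive_cell:
  fixes \<rho> :: "('a::second_countable_topology ^ 'i::finite) measure"
  assumes "prob_space \<rho>" and sets: "sets \<rho> = sets borel"
  shows "AE X in \<rho>. \<forall>n. 0 < measure \<rho> (cell n (\<lambda>i. discretize n (X $ i)))"
proof (subst AE_all_countable, intro allI)
  interpret prob_space \<rho> by fact
  note sets[measurable_cong]
  have space: "space \<rho> = UNIV" using sets_eq_imp_space_eq[OF sets] by simp
  fix n
  let ?d = "\<lambda>(X :: 'a ^ 'i) i. discretize n (X $ i)"
  have "finite (range ?d)"
    by (rule finite_subset[OF _ finite_PiE[of UNIV "\<lambda>_. range (discretize n)"]])
       (auto simp: finite_range_discretize)
  have d_cell: "?d -` {t} = cell n t" for t by (auto simp: cell_def)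
  have d: "?d \<in> measurable \<rho> (count_space UNIV)"
  proof (rule measurableI)
    fix A
    have "?d -` A = (\<Union>t\<in>A \<inter> range ?d. cell n t)" by (auto simp flip: d_cell)
    thus "?d -` A \<inter> space \<rho> \<in> sets \<rho>"
      using \<open>finite (range ?d)\<close> by (simp add: space sets.finite_UN)
  qed simp
  define p where "p = Abs_pmf (distr \<rho> (count_space UNIV) ?d)"
  have p: "measure_pmf p = distr \<rho> (count_space UNIV) ?d"
    unfolding p_def using \<open>finite (range ?d)\<close>
    by (intro measure_pmf_Abs_pmf_distr d countable_finite)
  have "AE t in distr \<rho> (count_space UNIV) ?d. t \<in> set_pmf p"
    unfolding p[symmetric] by (rule AE_measure_pmf)
  hence "AE X in \<rho>. ?d X \<in> set_pmf p" by (rule AE_distrD[OF d])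
  hence "AE X in \<rho>. 0 < pmf p (?d X)" by eventually_elim (rule pmf_positive)
  moreover have "pmf p t = measure \<rho> (cell n t)" for t
    unfolding pmf.rep_eq p by (subst measure_distr[OF d]) (simp_all add: d_cell space)
  ultimately show "AE X in \<rho>. 0 < measure \<rho> (cell n (?d X))" by simp
qed

lemma eventually_ex_avoiding_small_events:
  assumes A: "(\<lambda>n. measure_pmf.prob (p n) A) \<longlonglongrightarrow> \<beta>" and "0 < \<beta>"
    and B: "(\<lambda>n. measure_pmf.prob (p n) (B n)) \<longlonglongrightarrow> 0"
  shows "\<forall>\<^sub>F n in sequentially. \<exists>x\<in>A. x \<notin> B n"
proof -
  have "\<forall>\<^sub>F n in sequentially. \<beta> / 2 < measure_pmf.prob (p n) A"
    by (rule order_tendstoD(1)[OF A]) (use \<open>0 < \<beta>\<close> in simp)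
  moreover have "\<forall>\<^sub>F n in sequentially. measure_pmf.prob (p n) (B n) < \<beta> / 2"
    by (rule order_tendstoD(2)[OF B]) (use \<open>0 < \<beta>\<close> in simp)
  ultimately show ?thesis
  proof eventually_elim
    case (elim n)
    hence "\<not> A \<subseteq> B n" using measure_pmf.finite_measure_mono[of A "B n" "p n"] by auto
    thus ?case by blast
  qed
qed

lemma asymptotically_tight_if_positive_cells:
  fixes \<rho> :: "('a::second_countable_topology ^ 'i::finite) measure" and \<gamma> :: "nat \<Rightarrow> ('a ^ 'i) pmf"
  assumes cells: "\<And>N t. (\<lambda>n. measure_pmf.prob (\<gamma> n) (cell N t)) \<longlonglongrightarrow> measure \<rho> (cell N t)"
    and small: "\<And>n. measure_pmf.prob (\<gamma> n) {Y. ereal (c Y + e n) < (\<Sum>i\<in>UNIV. \<phi> n i (Y $ i))} \<le> e n"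
    and e_lim: "e \<longlonglongrightarrow> 0" and pos: "\<And>N. 0 < measure \<rho> (cell N (\<lambda>i. discretize N (X $ i)))"
  shows "asymptotically_tight c \<phi> X"
  unfolding asymptotically_tight_def
proof (intro allI impI)
  fix V and \<epsilon> :: real assume "open V" "X \<in> V" "0 < \<epsilon>"
  then obtain N where "\<forall>Y. (\<forall>i. discretize N (Y $ i) = discretize N (X $ i)) \<longrightarrow> Y \<in> V"
    using discretize_vec_eq_imp_in_open by blast
  hence N: "cell N (\<lambda>i. discretize N (X $ i)) \<subseteq> V" by (auto simp: cell_def)
  let ?bad = "\<lambda>n. {Y. ereal (c Y + e n) < (\<Sum>i\<in>UNIV. \<phi> n i (Y $ i))}"
  have "(\<lambda>n. measure_pmf.prob (\<gamma> n) (?bad n)) \<longlonglongrightarrow> 0"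
    by (rule tendsto_sandwich[OF _ _ tendsto_const e_lim]) (auto intro!: always_eventually small)
  hence "\<forall>\<^sub>F n in sequentially. \<exists>Y\<in>cell N (\<lambda>i. discretize N (X $ i)). Y \<notin> ?bad n"
    by (rule eventually_ex_avoiding_small_events[OF cells pos])
  moreover have "\<forall>\<^sub>F n in sequentially. e n < \<epsilon>" by (rule order_tendstoD(2)[OF e_lim \<open>0 < \<epsilon>\<close>])
  ultimately show "\<forall>\<^sub>F n in sequentially. \<exists>Y\<in>V. (\<Sum>i\<in>UNIV. \<phi> n i (Y $ i)) \<le> ereal (c Y + \<epsilon>)"
  proof eventually_elim
    case (elim n)
    then obtain Y where "Y \<in> V" "(\<Sum>i\<in>UNIV. \<phi> n i (Y $ i)) \<le> ereal (c Y + e n)"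
      using N by (auto simp: not_less)
    moreover have "ereal (c Y + e n) \<le> ereal (c Y + \<epsilon>)" using elim by simp
    ultimately show ?case using order_trans by blast
  qed
qed

lemma ex_tight_coupling:
  fixes \<mu> :: "'i::finite \<Rightarrow> 'a::euclidean_space measure" and c :: "'a ^ 'i \<Rightarrow> real"
  assumes prob: "\<And>i. prob_space (\<mu> i)"
    and \<mu>: "\<And>i. sets (\<mu> i) = sets borel" and cont: "continuous_on UNIV c"
  shows "\<exists>\<gamma>\<in>marginal_couplings \<mu>. \<exists>\<phi>\<in>admissible c. AE X in \<gamma>. (\<Sum>i\<in>UNIV. \<phi> i (X $ i)) = ereal (c X)"
proof -
  let ?e = "\<lambda>n. 1 / real (Suc n)"
  have "\<forall>n. \<exists>\<gamma>\<in>pmf_couplings (\<lambda>i. discretized_pmf n (\<mu> i)). \<exists>\<phi>\<in>admissible c.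
      measure_pmf.prob \<gamma> {X. ereal (c X + ?e n) < (\<Sum>i\<in>UNIV. \<phi> i (X $ i))} \<le> ?e n"
    by (rule allI, rule ex_almost_tight_potentials)
       (auto intro: finite_set_discretized_pmf[OF prob \<mu>])
  hence "\<exists>\<gamma> \<phi>. \<forall>n. \<gamma> n \<in> pmf_couplings (\<lambda>i. discretized_pmf n (\<mu> i)) \<and> \<phi> n \<in> admissible c \<and>
      measure_pmf.prob (\<gamma> n) {X. ereal (c X + ?e n) < (\<Sum>i\<in>UNIV. \<phi> n i (X $ i))} \<le> ?e n"
    by (simp only: Bex_def ex_simps(2)[symmetric] choice_iff)
  then obtain \<gamma> \<phi> where \<gamma>: "\<And>n. \<gamma> n \<in> pmf_couplings (\<lambda>i. discretized_pmf n (\<mu> i))"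
    and \<phi>: "\<And>n. \<phi> n \<in> admissible c"
    and small:
      "\<And>n. measure_pmf.prob (\<gamma> n) {X. ereal (c X + ?e n) < (\<Sum>i\<in>UNIV. \<phi> n i (X $ i))} \<le> ?e n"
    by blast
  obtain \<rho> r where \<rho>: "\<rho> \<in> marginal_couplings \<mu>" and r: "strict_mono r"
    and cells: "\<And>N t. (\<lambda>n. measure_pmf.prob (\<gamma> (r n)) (cell N t)) \<longlonglongrightarrow> measure \<rho> (cell N t)"
    using ex_limit_coupling[where \<mu> = \<mu>, OF prob \<mu> \<gamma>] by blast
  have "(\<lambda>n. ?e (r n)) \<longlonglongrightarrow> 0"
    using LIMSEQ_subseq_LIMSEQ[OF LIMSEQ_Suc[OF lim_1_over_n] r] by (simp add: o_def)
  note tight = asymptotically_tight_if_positive_cells[OF cells small this]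
  interpret \<rho>: prob_space \<rho> by (rule prob_space_coupling[OF \<rho>])
  have AE_tight: "AE X in \<rho>. asymptotically_tight c (\<lambda>n. \<phi> (r n)) X"
    using AE_positive_cell[OF \<rho>.prob_space_axioms sets_coupling[OF \<rho>]]
    by eventually_elim (rule tight, blast)
  then obtain X0 where "asymptotically_tight c (\<lambda>n. \<phi> (r n)) X0"
    using eventually_happens'[OF \<rho>.ae_filter_bot] by blast
  then obtain \<psi> where "\<psi> \<in> admissible c"
    and "\<And>X. asymptotically_tight c (\<lambda>n. \<phi> (r n)) X \<Longrightarrow> (\<Sum>i\<in>UNIV. \<psi> i (X $ i)) = ereal (c X)"
    using ex_tight_limit_potentials[OF cont \<phi>] by blast
  thus ?thesis
    using \<rho> AE_tight by (intro bexI[of _ \<rho>] bexI[of _ \<psi>]) (auto elim: eventually_mono)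
qed

section \<open>Duality\<close>

theorem multimarginal_duality:
  fixes \<mu> :: "'i::finite \<Rightarrow> 'a::euclidean_space measure"
  assumes "multimarginal \<mu> c b"
  shows "\<exists>\<gamma>\<in>marginal_couplings \<mu>. \<exists>\<phi>\<in>admissible c.
     (\<forall>\<gamma>'\<in>marginal_couplings \<mu>. integral\<^sup>L \<gamma>' c \<le> integral\<^sup>L \<gamma> c) \<and>
     (\<forall>\<psi>\<in>admissible c. (\<Sum>i\<in>UNIV. ereal_integral (\<mu> i) (\<phi> i)) \<le>
       (\<Sum>i\<in>UNIV. ereal_integral (\<mu> i) (\<psi> i))) \<and>
     ereal (integral\<^sup>L \<gamma> c) = (\<Sum>i\<in>UNIV. ereal_integral (\<mu> i) (\<phi> i)) \<and>
     (\<forall>i. \<phi> i = conj_potential c \<phi> i)"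
proof -
  interpret multimarginal \<mu> c b by fact
  obtain \<gamma> \<Phi> where \<gamma>: "\<gamma> \<in> marginal_couplings \<mu>" and \<Phi>: "\<Phi> \<in> admissible c"
    and tight: "AE X in \<gamma>. (\<Sum>i\<in>UNIV. \<Phi> i (X $ i)) = ereal (c X)"
    using ex_tight_coupling[where \<mu> = \<mu>, OF prob_space_marginal sets_marginal_borel continuous_cost]
    by blast
  interpret \<gamma>: prob_space \<gamma> by (rule prob_space_coupling[OF \<gamma>])
  obtain X0 where X0: "(\<Sum>i\<in>UNIV. \<Phi> i (X0 $ i)) = ereal (c X0)"
    using eventually_happens'[OF \<gamma>.ae_filter_bot tight] by blast
  obtain \<phi> where \<phi>: "\<phi> \<in> admissible c" and \<phi>_le: "\<And>i x. \<phi> i x \<le> \<Phi> i x"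
    and conj: "\<And>i. \<phi> i = conj_potential c \<phi> i"
    using ex_conjugate_potentials[OF continuous_cost \<Phi> potential_lt_PInfty_of_sum_eq_ereal[OF \<Phi> X0]]
    by blast
  have "AE X in \<gamma>. (\<Sum>i\<in>UNIV. \<phi> i (X $ i)) = ereal (c X)"
    using tight
  proof eventually_elim
    case (elim X)
    have "(\<Sum>i\<in>UNIV. \<phi> i (X $ i)) \<le> ereal (c X)"
      unfolding elim[symmetric] by (rule sum_mono) (rule \<phi>_le)
    thus ?case using admissibleD(3)[OF \<phi>] by (rule antisym)
  qed
  hence attained: "(\<Sum>i\<in>UNIV. ereal_integral (\<mu> i) (\<phi> i)) = ereal (integral\<^sup>L \<gamma> c)"
    by (rule complementary_slackness[OF \<gamma> \<phi>])
  have "integral\<^sup>L \<gamma>' c \<le> integral\<^sup>L \<gamma> c" if "\<gamma>' \<in> marginal_couplings \<mu>" for \<gamma>'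
    using weak_duality[OF that \<phi>] by (simp add: attained)
  thus ?thesis
    using weak_duality[OF \<gamma>]
    by (intro bexI[OF _ \<gamma>] bexI[OF _ \<phi>] conjI ballI allI conj) (simp_all add: attained)
qed

section \<open>The determinant\<close>

lemma det_cols_eq_det: "det_cols X = det X"
  by (simp add: det_cols_def)

lemma continuous_det_cols: "continuous_on UNIV (det_cols :: real ^ 'd::finite ^ 'd \<Rightarrow> real)"
  unfolding det_cols_eq_det det_def
  by (intro continuous_intros)

lemma abs_det_le_prod_norm:
  fixes X :: "real ^ 'd::finite ^ 'd"
  shows "\<bar>det X\<bar> \<le> fact CARD('d) * (\<Prod>i\<in>UNIV. norm (X $ i))"
proof -
  let ?P = "{\<sigma>. \<sigma> permutes (UNIV :: 'd set)}"
  have "\<bar>det X\<bar> \<le> (\<Sum>\<sigma>\<in>?P. \<bar>of_int (sign \<sigma>) * (\<Prod>i\<in>UNIV. X $ i $ \<sigma> i)\<bar>)"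
    unfolding det_def by (rule sum_abs)
  also have "\<dots> \<le> (\<Sum>\<sigma>\<in>?P. \<Prod>i\<in>UNIV. norm (X $ i))"
  proof (rule sum_mono)
    fix \<sigma> :: "'d \<Rightarrow> 'd"
    have "\<bar>\<Prod>i\<in>UNIV. X $ i $ \<sigma> i\<bar> \<le> (\<Prod>i\<in>UNIV. norm (X $ i))"
      unfolding abs_prod by (rule prod_mono) (auto intro: component_le_norm_cart)
    thus "\<bar>of_int (sign \<sigma>) * (\<Prod>i\<in>UNIV. X $ i $ \<sigma> i)\<bar> \<le> (\<Prod>i\<in>UNIV. norm (X $ i))"
      by (simp add: abs_mult sign_def)
  qed
  also have "\<dots> = fact CARD('d) * (\<Prod>i\<in>UNIV. norm (X $ i))"
    by (simp add: card_permutations[OF refl])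
  finally show ?thesis .
qed

lemma weighted_am_gm:
  fixes a p :: "'i \<Rightarrow> real"
  assumes "finite I" "I \<noteq> {}" and a: "\<And>i. i \<in> I \<Longrightarrow> a i \<ge> 0"
    and p: "\<And>i. i \<in> I \<Longrightarrow> p i > 0" and sum1: "(\<Sum>i\<in>I. 1 / p i) = 1"
  shows "(\<Prod>i\<in>I. a i) \<le> (\<Sum>i\<in>I. a i powr p i / p i)"
proof (cases "\<exists>i\<in>I. a i = 0")
  case True
  hence "(\<Prod>i\<in>I. a i) = 0" using assms(1) by (simp add: prod_zero)
  thus ?thesis using p by (simp add: sum_nonneg less_imp_le)
next
  case False
  hence pos: "a i > 0" if "i \<in> I" for i using a[OF that] that by force
  have "(\<Prod>i\<in>I. a i) = exp (\<Sum>i\<in>I. (1 / p i) *\<^sub>R (p i * ln (a i)))"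
    unfolding exp_sum[OF assms(1)]
  proof (rule prod.cong[OF refl])
    fix i assume i: "i \<in> I"
    thus "a i = exp ((1 / p i) *\<^sub>R (p i * ln (a i)))" using pos[OF i] p[OF i] by simp
  qed
  also have "\<dots> \<le> (\<Sum>i\<in>I. 1 / p i * exp (p i * ln (a i)))"
    by (rule convex_on_sum[OF assms(1,2) exp_convex sum1]) (use p in \<open>auto intro: less_imp_le\<close>)
  also have "\<dots> = (\<Sum>i\<in>I. a i powr p i / p i)"
    using pos by (intro sum.cong) (auto simp: powr_def less_imp_neq[symmetric])
  finally show ?thesis .
qed

lemma abs_det_cols_le_moments:
  fixes X :: "real ^ 'd::finite ^ 'd"
  assumes p: "\<And>i. p i > 0" and p_sum: "(\<Sum>i\<in>UNIV. 1 / p i) = 1"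
  shows "\<bar>det_cols X\<bar> \<le> (\<Sum>i\<in>UNIV. fact CARD('d) * (norm (X $ i) powr p i / p i))"
proof -
  have "fact CARD('d) * (\<Prod>i\<in>UNIV. norm (X $ i)) \<le>
      fact CARD('d) * (\<Sum>i\<in>UNIV. norm (X $ i) powr p i / p i)"
    by (intro mult_left_mono weighted_am_gm p p_sum) auto
  thus ?thesis
    using abs_det_le_prod_norm[of X] by (simp add: det_cols_eq_det sum_distrib_left)
qed

lemma integrable_of_sum_nn_integral_finite:
  fixes g :: "'i::finite \<Rightarrow> 'a \<Rightarrow> real"
  assumes "\<And>i. g i \<in> borel_measurable (M i)" "\<And>i x. 0 \<le> g i x"
    and "(\<Sum>i\<in>UNIV. \<integral>\<^sup>+ x. ennreal (g i x) \<partial>M i) < \<infinity>"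
  shows "integrable (M i) (g i)"
  using assms(1,2)
proof (intro integrableI_nonneg)
  have "(\<integral>\<^sup>+ x. ennreal (g i x) \<partial>M i) \<le> (\<Sum>i\<in>UNIV. \<integral>\<^sup>+ x. ennreal (g i x) \<partial>M i)"
    by (rule member_le_sum) auto
  thus "(\<integral>\<^sup>+ x. ennreal (g i x) \<partial>M i) < \<infinity>" using assms(3) by (rule le_less_trans)
qed auto

theorem theorem3p2:
  fixes \<mu> :: "'d::finite \<Rightarrow> (real ^ 'd) measure"
    and p :: "'d \<Rightarrow> real"
  assumes prob: "\<And>i. prob_space (\<mu> i)"
    and borel: "\<And>i. sets (\<mu> i) = sets borel"
    and p_gt: "\<And>i. p i > 1"
    and p_sum: "(\<Sum>i\<in>UNIV. 1 / p i) = 1"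
    and moments: "(\<Sum>i\<in>UNIV. \<integral>\<^sup>+ x. ennreal (norm x powr p i / p i) \<partial>(\<mu> i)) < \<infinity>"
  shows "\<exists>\<gamma> \<in> couplings \<mu>. \<exists>\<phi> \<in> dual_admissible.
           (\<forall>\<gamma>' \<in> couplings \<mu>. integral\<^sup>L \<gamma>' det_cols \<le> integral\<^sup>L \<gamma> det_cols) \<and>
           (\<forall>\<psi> \<in> dual_admissible. dual_value \<mu> \<phi> \<le> dual_value \<mu> \<psi>) \<and>
           ereal (integral\<^sup>L \<gamma> det_cols) = dual_value \<mu> \<phi> \<and>
           (\<forall>i x. \<phi> i x = (SUP X \<in> {X :: real ^ 'd ^ 'd. X $ i = x}.
                               ereal (det_cols X) - (\<Sum>j\<in>UNIV - {i}. \<phi> j (X $ j))))"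
proof -
  have p_pos: "p i > 0" for i using p_gt[of i] by simp
  have "integrable (\<mu> i) (\<lambda>x. norm x powr p i / p i)" for i
    using moments p_pos
    by (intro integrable_of_sum_nn_integral_finite[of "\<lambda>i x. norm x powr p i / p i"])
       (auto simp: measurable_cong_sets[OF borel refl] less_imp_le)
  hence "integrable (\<mu> i) (\<lambda>x. fact CARD('d) * (norm x powr p i / p i))" for i
    by (rule integrable_mult_right)
  hence "multimarginal \<mu> det_cols (\<lambda>i x. fact CARD('d) * (norm x powr p i / p i))"
    by (intro multimarginal.intro prob borel continuous_det_cols abs_det_cols_le_moments p_pos p_sum)
  note multimarginal_duality[OF this]
  moreover have "couplings \<mu> = marginal_couplings \<mu>"
    "dual_admissible = admissible (det_cols :: real ^ 'd ^ 'd \<Rightarrow> real)"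
    by (auto simp: couplings_def marginal_couplings_def dual_admissible_def admissible_def)
  ultimately show ?thesis unfolding dual_value_def fun_eq_iff conj_potential_def by simp
qed

end
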